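(* Let $n\ge 2$ and let $G$ be the cyclic group of order $pm$, with modules $V_n$, $V_{n-1}$, the $G$-equivariant surjection $\phi:V_n\to V_{n-1}$, and induced inclusion $\phi^*:F[V_{n-1}]\hookrightarrow F[V_n]$ as in the context. Let $l$ be the smallest non-negative integer such that $N_H(x_n)(N_H(x_{n-1}))^l\in F[V_n]^G$ (such an integer exists), and let $k$ be the smallest non-negative integer such that $f_i:=x_nx_{i+1}^{p-1}x_i^{k}\in F[V_n]^{M}$ for $1\le i\le n-2$. Let $S\subseteq F[V_{n-1}]^G$ be a separating set for $V_{n-1}$. Then $\phi^{*}(S)$ together with the set $T$ consisting of \[N_H(x_n)(N_H(x_{n-1}))^l,\quad N_G(x_n),\quad \operatorname{Tr}^G_M(f_i)\quad\text{for } 1\le i\le n-2,\] is a separating set for $V_n$.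
   Context: $p$ is a prime, $F$ is an algebraically closed field of characteristic $p$, $m$ is a positive integer coprime to $p$, and $G$ is the cyclic group of order $pm$ with subgroups $H$ of order $p$ and $M$ of order $m$. $V_n$ is an indecomposable $G$-module of dimension $n$ (so $n\le p$) over $F$, with a basis $e_1,\dots,e_n$ such that, for a generator $\sigma$ of $H$ and a generator $\alpha$ of $M$, $\sigma^{-1}(e_i)=e_i+e_{i+1}$ for $1\le i\le n-1$, $\sigma^{-1}(e_n)=e_n$, and $\alpha(e_i)=\lambda e_i$ for $1\le i\le n$, where $\lambda\in F$ is a primitive $m$-th root of unity. $F[V]=S(V^* )$ has the action $g(f)=f\circ g^{-1}$, and $F[V]^K$ is the ring of invariants of a subgroup $K$. Let $x_1,\dots,x_n$ be the dual basis of $V_n^*$, so $F[V_n]=F[x_1,\dots,x_n]$, $\sigma(x_1)=x_1$, $\sigma(x_i)=x_i+x_{i-1}$ for $2\le i\le n$, and $\alpha(x_i)=\lambda^{-1}x_i$ for all $i$. $V_{n-1}$ is the module defined in the same way with $n-1$ in place of $n$ (same $\sigma,\alpha,\lambda$). In coordinates with respect to these bases, $\phi:V_n\to V_{n-1}$ is $(c_1,\dots,c_n)\mapsto(c_1,\dots,c_{n-1})$, so that $\phi^*$, $f\mapsto f\circ\phi$, identifies $F[V_{n-1}]$ with $F[x_1,\dots,x_{n-1}]\subseteq F[V_n]$. For $f\in F[V_n]^M$, $\operatorname{Tr}^G_M(f)=\sum_{g\in G/M}g(f)$; for $f\in F[V_n]$ and a subgroup $K\subseteq G$, $N_K(f)=\prod_{g\in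 K}g(f)$. A subset $A\subseteq F[V]^G$ is a separating set for $V$ if for all $u,w\in V$: $f(u)=f(w)$ for all $f\in A$ implies $f(u)=f(w)$ for all $f\in F[V]^G$. *)

theory Defs
  imports "HOL-Algebra.Elementary_Groups" "HOL-Algebra.Group_Action" "HOL-Algebra.Left_Coset"
    "HOL-Library.Poly_Mapping" "HOL-Computational_Algebra.Computational_Algebra"
begin

subsection \<open>Polynomials in the variables x_1, x_2, ...\<close>

type_synonym 'a mpoly = "(nat \<Rightarrow>\<^sub>0 nat) \<Rightarrow>\<^sub>0 'a"

definition const :: "'a::comm_ring_1 \<Rightarrow> 'a mpoly" where
  "const c = Poly_Mapping.single 0 c"

definition var :: "nat \<Rightarrow> 'a::comm_ring_1 mpoly" where
  "var i = Poly_Mapping.single (Poly_Mapping.single i 1) 1"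

definition poly_ring :: "nat \<Rightarrow> 'a::comm_ring_1 mpoly set" where
  "poly_ring n = {f. \<forall>t \<in> Poly_Mapping.keys f. Poly_Mapping.keys t \<subseteq> {1..n}}"

text \<open>The value of \<^term>\<open>f\<close> at \<^term>\<open>y\<close>, the coefficients being mapped by \<^term>\<open>h\<close>. It is used
  with the identity for evaluation at points and with \<^const>\<open>const\<close> for substitution.\<close>

definition insertion :: "('a::comm_ring_1 \<Rightarrow> 'b::comm_ring_1) \<Rightarrow> (nat \<Rightarrow> 'b) \<Rightarrow> 'a mpoly \<Rightarrow> 'b" where
  "insertion h y f =
    (\<Sum>t \<in> Poly_Mapping.keys f. h (Poly_Mapping.lookup f t) *
      (\<Prod>i \<in> Poly_Mapping.keys t. y i ^ Poly_Mapping.lookup t i))"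


subsection \<open>Modules over a group, with a chosen basis\<close>

record ('g, 'a, 'v) based_module =
  smul :: "'a \<Rightarrow> 'v \<Rightarrow> 'v"
  rep :: "'g \<Rightarrow> 'v \<Rightarrow> 'v"
  mdim :: nat
  bvec :: "nat \<Rightarrow> 'v"   \<comment> \<open>only the values at 1, ..., mdim matter\<close>

definition based_module ::
  "('g, 'b) monoid_scheme \<Rightarrow> ('g, 'a::field, 'v::ab_group_add) based_module \<Rightarrow> bool" where
  "based_module G V \<longleftrightarrow>
    vector_space (smul V) \<and>
    group_action G UNIV (rep V) \<and>
    (\<forall>g \<in> carrier G. Vector_Spaces.linear (smul V) (smul V) (rep V g)) \<and>
    inj_on (bvec V) {1..mdim V} \<and>
    \<not> module.dependent (smul V) (bvec V ` {1..mdim V}) \<and>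
    module.span (smul V) (bvec V ` {1..mdim V}) = UNIV"

definition coord :: "('g, 'a::field, 'v::ab_group_add) based_module \<Rightarrow> nat \<Rightarrow> 'v \<Rightarrow> 'a" where
  "coord V i v = module.representation (smul V) (bvec V ` {1..mdim V}) v (bvec V i)"

text \<open>F[V] = S(V*) is \<^term>\<open>poly_ring (mdim V)\<close>, the variable x_i being the i-th element of
  the dual basis.\<close>

definition eval :: "('g, 'a::field, 'v::ab_group_add) based_module \<Rightarrow> 'a mpoly \<Rightarrow> 'v \<Rightarrow> 'a" where
  "eval V f v = insertion (\<lambda>c. c) (\<lambda>i. coord V i v) f"

text \<open>For a linear map \<^term>\<open>L\<close> from V to W this is the map F[W] \<rightarrow> F[V], f \<mapsto> f \<circ> L, that
  is, the algebra homomorphism sending x_i to the linear form x_i \<circ> L = \<Sum>j. x_i (L e_j) x_j.\<close>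

definition pullback ::
  "('g, 'a::field, 'v::ab_group_add) based_module \<Rightarrow> ('g, 'a, 'w::ab_group_add) based_module \<Rightarrow>
    ('v \<Rightarrow> 'w) \<Rightarrow> 'a mpoly \<Rightarrow> 'a mpoly" where
  "pullback V W L f =
    insertion const (\<lambda>i. \<Sum>j = 1..mdim V. const (coord W i (L (bvec V j))) * var j) f"

definition act ::
  "('g, 'b) monoid_scheme \<Rightarrow> ('g, 'a::field, 'v::ab_group_add) based_module \<Rightarrow>
    'g \<Rightarrow> 'a mpoly \<Rightarrow> 'a mpoly" where
  "act G V g f = pullback V V (rep V (inv\<^bsub>G\<^esub> g)) f"

definition invariant_ring ::
  "('g, 'b) monoid_scheme \<Rightarrow> ('g, 'a::field, 'v::ab_group_add) based_module \<Rightarrow>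
    'g set \<Rightarrow> 'a mpoly set" where
  "invariant_ring G V K = {f \<in> poly_ring (mdim V). \<forall>g \<in> K. act G V g f = f}"

text \<open>The summand does not depend on the chosen coset representative when \<^term>\<open>f\<close> is
  invariant under \<^term>\<open>M\<close>.\<close>

definition rel_trace ::
  "('g, 'b) monoid_scheme \<Rightarrow> ('g, 'a::field, 'v::ab_group_add) based_module \<Rightarrow>
    'g set \<Rightarrow> 'a mpoly \<Rightarrow> 'a mpoly" where
  "rel_trace G V M f = (\<Sum>C \<in> lcosets\<^bsub>G\<^esub> M. act G V (SOME g. g \<in> C) f)"

definition orbit_norm ::
  "('g, 'b) monoid_scheme \<Rightarrow> ('g, 'a::field, 'v::ab_group_add) based_module \<Rightarrow>
    'g set \<Rightarrow> 'a mpoly \<Rightarrow> 'a mpoly" where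
  "orbit_norm G V K f = (\<Prod>g \<in> K. act G V g f)"

definition separating_set ::
  "('g, 'b) monoid_scheme \<Rightarrow> ('g, 'a::field, 'v::ab_group_add) based_module \<Rightarrow>
    'a mpoly set \<Rightarrow> bool" where
  "separating_set G V A \<longleftrightarrow>
    A \<subseteq> invariant_ring G V (carrier G) \<and>
    (\<forall>u w. (\<forall>f \<in> A. eval V f u = eval V f w) \<longrightarrow>
      (\<forall>f \<in> invariant_ring G V (carrier G). eval V f u = eval V f w))"


subsection \<open>The modules V_n\<close>

definition primitive_root_of_unity :: "nat \<Rightarrow> 'a::field \<Rightarrow> bool" where
  "primitive_root_of_unity m z \<longleftrightarrow> z ^ m = 1 \<and> (\<forall>j. 0 < j \<and> j < m \<longrightarrow> z ^ j \<noteq> 1)"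

definition jordan_module ::
  "('g, 'b) monoid_scheme \<Rightarrow> 'g \<Rightarrow> 'g \<Rightarrow> 'a::field \<Rightarrow> nat \<Rightarrow>
    ('g, 'a, 'v::ab_group_add) based_module \<Rightarrow> bool" where
  "jordan_module G \<sigma> \<alpha> \<zeta> n V \<longleftrightarrow>
    based_module G V \<and> mdim V = n \<and>
    (\<forall>i. 1 \<le> i \<and> i < n \<longrightarrow> rep V (inv\<^bsub>G\<^esub> \<sigma>) (bvec V i) = bvec V i + bvec V (i + 1)) \<and>
    rep V (inv\<^bsub>G\<^esub> \<sigma>) (bvec V n) = bvec V n \<and>
    (\<forall>i. 1 \<le> i \<and> i \<le> n \<longrightarrow> rep V \<alpha> (bvec V i) = smul V \<zeta> (bvec V i))"

end

theory Submission
  imports "HOL-Algebra.Multiplicative_Group" Defs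
begin

text \<open>
  Two points \<open>u\<close>, \<open>w\<close> of \<open>V_n\<close> on which all the listed invariants agree lie in one orbit of \<open>G\<close>;
  then every invariant agrees on them.

  The image of \<open>S\<close> settles everything except the last coordinate. Invariants of a finite group over
  an infinite field separate orbits (\<open>invariants_separate_orbits\<close>), so \<open>\<phi> u\<close> and \<open>\<phi> w\<close> lie in one
  orbit. As \<open>\<phi>\<close> is equivariant, \<open>w\<close> may be replaced by a translate that has the same first \<open>n - 1\<close>
  coordinates as \<open>u\<close>.

  The set \<open>T\<close> then has to decide about the last coordinate (\<open>separation_in_fibre\<close>).
  \<^item> If one of \<open>u_1, ..., u_{n-2}\<close> is nonzero, let \<open>u_i\<close> be the first such. On a vector whose first
    nonzero coordinate is the \<open>i\<close>-th, the powers of \<open>\<sigma>\<inverse>\<close> fix the \<open>i\<close>-th coordinate and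
    move the next one through \<open>u_{i+1} + j u_i\<close>. They also keep \<open>u_n - w_n\<close>. Hence the values of the trace
    of \<open>x_n x_{i+1}^{p-1} x_i^k\<close> at \<open>u\<close> and \<open>w\<close> differ by
    \<open>(u_n - w_n) u_i^k\<close> times the sum of \<open>(u_{i+1} + j u_i)^{p-1}\<close> over \<open>j < p\<close>. This sum is
    \<open>-u_i^{p-1}\<close> (\<open>sum_progression_power\<close>), so \<open>u_n = w_n\<close>.
  \<^item> If \<open>u_{n-1}\<close> is the first nonzero coordinate, the norm of \<open>x_{n-1}\<close> over \<open>H\<close> has the nonzero value
    \<open>u_{n-1}^p\<close> at both points, so the norm of \<open>x_n\<close> over \<open>H\<close> agrees on them. That norm is the
    product of all \<open>u_n + j u_{n-1}\<close>, an Artin-Schreier polynomial in \<open>u_n\<close> whose fibres are the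
    translates by multiples of \<open>u_{n-1}\<close> (\<open>Artin_Schreier_fibre\<close>). So a power of \<open>\<sigma>\<inverse>\<close> maps \<open>w\<close> to \<open>u\<close>.
  \<^item> If only the last coordinates can be nonzero, the norm of \<open>x_n\<close> over \<open>G\<close> is a nonzero multiple of
    \<open>u_n^{pm}\<close>. Since the Frobenius map is injective, \<open>u_n^m = w_n^m\<close>, and a power of \<open>\<alpha>\<close> maps \<open>w\<close> to \<open>u\<close>.

  Invariance is stated for formal polynomials, but the field is infinite, so a polynomial is
  determined by its values (\<open>poly_ring_identity\<close>, \<open>eval_eqI\<close>). All invariance statements are
  therefore proved pointwise, as statements about functions on the module (\<open>invariant_ring_iff\<close>).
\<close>

section \<open>Univariate facts over fields\<close>

lemma poly_eq_0_if_many_roots: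
  fixes P :: "'a::idom poly"
  assumes "finite A" "\<And>x. x \<in> A \<Longrightarrow> poly P x = 0" "degree P < card A"
  shows "P = 0"
proof (rule ccontr)
  assume "P \<noteq> 0"
  then have "card A \<le> card {x. poly P x = 0}"
    using assms(2) by (intro card_mono poly_roots_finite) auto
  also have "\<dots> \<le> degree P"
    using \<open>P \<noteq> 0\<close> by (rule card_poly_roots_bound)
  finally show False using assms(3) by simp
qed

lemma root_mem_if_enough_roots:
  fixes P :: "'a::idom poly"
  assumes "P \<noteq> 0" "finite A" "\<And>x. x \<in> A \<Longrightarrow> poly P x = 0" "degree P \<le> card A" "poly P y = 0"
  shows "y \<in> A"
proof (rule ccontr)
  assume "y \<notin> A"
  then have "P = 0"
    using assms(2-5) by (intro poly_eq_0_if_many_roots[of "insert y A"]) auto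
  with \<open>P \<noteq> 0\<close> show False by contradiction
qed

text \<open>If the field were finite, one plus the product of all \<open>X - a\<close> would have no root.\<close>

lemma infinite_UNIV_alg_closed: "infinite (UNIV :: 'a::alg_closed_field set)"
proof
  assume fin: "finite (UNIV :: 'a set)"
  define P :: "'a poly" where "P = (\<Prod>a\<in>UNIV. [:-a, 1:])"
  have "degree P = (\<Sum>a\<in>(UNIV :: 'a set). 1)"
    unfolding P_def by (subst degree_prod_eq_sum_degree) auto
  then have "0 < degree P"
    using fin by (simp add: finite_UNIV_card_ge_0)
  then have "0 < degree (P + 1)"
    by (subst degree_add_eq_left) auto
  then obtain x where "poly (P + 1) x = 0"
    using alg_closed_imp_poly_has_root by blast
  moreover have "poly P x = 0"
    unfolding P_def poly_prod using fin by (intro prod_zero) auto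
  ultimately show False by simp
qed

text \<open>Finitely many hyperplanes cannot cover the points \<open>(t, t^2, ..., t^n)\<close> of an infinite set of
  parameters, since each of them meets the moment curve in the roots of a nonzero polynomial.
  This supplies a linear form that separates finitely many vectors, and integer weights that
  separate finitely many monomials.\<close>

lemma generic_point_on_moment_curve:
  fixes D :: "(nat \<Rightarrow> 'a::idom) set"
  assumes "finite D" "\<And>d. d \<in> D \<Longrightarrow> \<exists>i\<in>{1..n}. d i \<noteq> 0" "infinite A"
  shows "\<exists>t\<in>A. \<forall>d\<in>D. (\<Sum>i = 1..n. d i * t ^ i) \<noteq> 0"
proof -
  define P :: "(nat \<Rightarrow> 'a) \<Rightarrow> 'a poly" where "P = (\<lambda>d. \<Sum>i = 1..n. monom (d i) i)"
  have "P d \<noteq> 0" if "d \<in> D" for d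
  proof -
    obtain i where i: "i \<in> {1..n}" "d i \<noteq> 0"
      using assms(2)[OF \<open>d \<in> D\<close>] by blast
    have "coeff (P d) i = d i"
      using i(1) by (simp add: P_def coeff_sum)
    with i(2) show ?thesis by auto
  qed
  then have "finite (\<Union>d\<in>D. {t. poly (P d) t = 0})"
    using assms(1) poly_roots_finite by auto
  then obtain t where "t \<in> A" "t \<notin> (\<Union>d\<in>D. {t. poly (P d) t = 0})"
    using assms(3) finite_subset[of A] by blast
  then show ?thesis
    by (intro bexI[of _ t]) (auto simp: P_def poly_sum poly_monom)
qed

lemma of_nat_eq_iff_below_CHAR:
  assumes "i < CHAR('a::comm_ring_1)" "j < CHAR('a)"
  shows "(of_nat i :: 'a) = of_nat j \<longleftrightarrow> i = j"
proof -
  have *: "i = j" if "of_nat i = (of_nat j :: 'a)" "i \<le> j" "j < CHAR('a)" for i j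
  proof -
    have "of_nat (j - i) = (0 :: 'a)"
      using that by (simp add: of_nat_diff)
    then have "CHAR('a) dvd j - i"
      by (simp add: of_nat_eq_0_iff_char_dvd)
    then show "i = j"
      using that by (auto dest: dvd_imp_le)
  qed
  show ?thesis
    using *[of i j] *[of j i] assms by (cases "i \<le> j") auto
qed

lemma prime_field_progression:
  fixes b :: "'a::field"
  assumes "b \<noteq> 0"
  shows "inj_on (\<lambda>j. a + of_nat j * b) {..<CHAR('a)}"
  using assms by (auto simp: inj_on_def of_nat_eq_iff_below_CHAR)

lemma of_nat_power_CHAR:
  assumes "prime CHAR('a::comm_ring_1)"
  shows "(of_nat j :: 'a) ^ CHAR('a) = of_nat j"
proof (induction j)
  case 0
  then show ?case using assms prime_gt_0_nat by (simp add: power_0_left)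
next
  case (Suc j)
  then show ?case
    using freshmans_dream[OF assms refl, of 1 "of_nat j"] by simp
qed

lemma CHAR_power_inj:
  fixes x y :: "'a::idom"
  assumes "prime CHAR('a)" "x ^ CHAR('a) = y ^ CHAR('a)"
  shows "x = y"
proof -
  have "(x - y) ^ CHAR('a) + y ^ CHAR('a) = x ^ CHAR('a)"
    using freshmans_dream[OF assms(1) refl, of "x - y" y] by simp
  then show ?thesis
    using assms by simp
qed

text \<open>The summand depends on \<open>j\<close> only through its class in the prime field, which the shift by one
  permutes.\<close>

lemma sum_of_nat_shift:
  fixes F :: "'a::comm_ring_1 \<Rightarrow> 'b::comm_ring_1"
  assumes "0 < CHAR('a)"
  shows "(\<Sum>j<CHAR('a). F (of_nat (Suc j))) = (\<Sum>j<CHAR('a). F (of_nat j))"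
proof -
  obtain q where q: "CHAR('a) = Suc q"
    using assms gr0_implies_Suc by blast
  have "F (of_nat (Suc q)) = F (of_nat 0)"
    unfolding q[symmetric] by simp
  then show ?thesis
    unfolding q by (subst sum.lessThan_Suc, subst sum.lessThan_Suc_shift) simp
qed

lemma prod_of_nat_shift:
  fixes F :: "'a::comm_ring_1 \<Rightarrow> 'b::comm_ring_1"
  assumes "0 < CHAR('a)"
  shows "(\<Prod>j<CHAR('a). F (of_nat (Suc j))) = (\<Prod>j<CHAR('a). F (of_nat j))"
proof -
  obtain q where q: "CHAR('a) = Suc q"
    using assms gr0_implies_Suc by blast
  have "F (of_nat (Suc q)) = F (of_nat 0)"
    unfolding q[symmetric] by simp
  then show ?thesis
    unfolding q by (subst prod.lessThan_Suc, subst prod.lessThan_Suc_shift) simp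
qed

lemma prod_progression_translate:
  fixes a b :: "'a::comm_ring_1"
  assumes "0 < CHAR('a)"
  shows "(\<Prod>j<CHAR('a). (a + of_nat r * b) + of_nat j * b) = (\<Prod>j<CHAR('a). a + of_nat j * b)"
proof (induction r)
  case (Suc r)
  have "(\<Prod>j<CHAR('a). (a + of_nat (Suc r) * b) + of_nat j * b)
      = (\<Prod>j<CHAR('a). (a + of_nat r * b) + of_nat (Suc j) * b)"
    by (simp add: algebra_simps)
  also have "\<dots> = (\<Prod>j<CHAR('a). (a + of_nat r * b) + of_nat j * b)"
    using assms by (rule prod_of_nat_shift)
  finally show ?case using Suc.IH by simp
qed simp

text \<open>As a polynomial in \<open>a\<close>, the product has degree \<open>p\<close>, and it takes the same value at the \<open>p\<close>
  distinct points \<open>a + r b\<close>. These exhaust the fibre.\<close>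

lemma Artin_Schreier_fibre:
  fixes a a' b :: "'a::field"
  assumes "0 < CHAR('a)" "b \<noteq> 0"
    and "(\<Prod>j<CHAR('a). a + of_nat j * b) = (\<Prod>j<CHAR('a). a' + of_nat j * b)"
  shows "\<exists>r. a' = a + of_nat r * b"
proof -
  define Q where "Q = (\<Prod>j<CHAR('a). [:of_nat j * b, 1:])"
  define P where "P = Q - [:poly Q a:]"
  have Q: "poly Q x = (\<Prod>j<CHAR('a). x + of_nat j * b)" for x
    by (simp add: Q_def poly_prod add.commute)
  have "degree Q = CHAR('a)"
    unfolding Q_def by (subst degree_prod_eq_sum_degree) auto
  then have deg: "degree P = CHAR('a)"
    using assms(1) unfolding P_def diff_conv_add_uminus by (subst degree_add_eq_left) auto
  have "a' \<in> (\<lambda>r. a + of_nat r * b) ` {..<CHAR('a)}"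
  proof (rule root_mem_if_enough_roots)
    show "P \<noteq> 0" using deg assms(1) by auto
    show "degree P \<le> card ((\<lambda>r. a + of_nat r * b) ` {..<CHAR('a)})"
      using assms(2) by (simp add: deg card_image prime_field_progression)
    show "poly P x = 0" if "x \<in> (\<lambda>r. a + of_nat r * b) ` {..<CHAR('a)}" for x
      using that prod_progression_translate[OF assms(1), of a _ b] by (auto simp: P_def Q)
    show "poly P a' = 0" using assms(3) by (simp add: P_def Q)
  qed simp
  then show ?thesis by blast
qed

text \<open>As a polynomial in \<open>a\<close>, the sum is invariant under \<open>a \<mapsto> a + b\<close>, so it takes one value at
  \<open>p\<close> points. Its degree is below \<open>p\<close>, hence it is constant. At \<open>a = 0\<close>, Fermat's little theorem
  turns it into \<open>p - 1\<close> copies of \<open>b^{p-1}\<close>.\<close>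

lemma sum_progression_power:
  fixes a b :: "'a::field"
  assumes "prime CHAR('a)" "b \<noteq> 0"
  shows "(\<Sum>j<CHAR('a). (a + of_nat j * b) ^ (CHAR('a) - 1)) = - (b ^ (CHAR('a) - 1))"
proof -
  let ?p = "CHAR('a)"
  define R where "R = (\<Sum>j<?p. [:of_nat j * b, 1:] ^ (?p - 1))"
  have p: "0 < ?p" using assms(1) prime_gt_0_nat by blast
  have R: "poly R x = (\<Sum>j<?p. (x + of_nat j * b) ^ (?p - 1))" for x
    by (simp add: R_def poly_sum add.commute)
  have step: "poly R (x + b) = poly R x" for x
    using sum_of_nat_shift[OF p, of "\<lambda>z. (x + z * b) ^ (?p - 1)"] by (simp add: R algebra_simps)
  have "degree R \<le> ?p - 1"
    unfolding R_def by (intro degree_sum_le order.trans[OF degree_power_le]) auto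
  then have "degree (R - [:poly R 0:]) \<le> ?p - 1"
    by (intro degree_diff_le) auto
  moreover have "poly R (of_nat r * b) = poly R 0" for r
  proof (induction r)
    case (Suc r)
    then show ?case using step[of "of_nat r * b"] by (simp add: algebra_simps)
  qed simp
  ultimately have "R - [:poly R 0:] = 0"
    using prime_field_progression[OF assms(2), of 0] p
    by (intro poly_eq_0_if_many_roots[of "(\<lambda>r. of_nat r * b) ` {..<?p}"]) (auto simp: card_image)
  then have "poly (R - [:poly R 0:]) a = 0" by simp
  then have "poly R a = poly R 0" by simp
  also have "\<dots> = (\<Sum>j<?p. of_nat j ^ (?p - 1)) * b ^ (?p - 1)"
    by (simp add: R power_mult_distrib sum_distrib_right)
  also have "(\<Sum>j<?p. of_nat j ^ (?p - 1)) = (\<Sum>j<?p. if j = 0 then 0 else (1 :: 'a))"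
  proof (rule sum.cong)
    fix j assume j: "j \<in> {..<?p}"
    show "of_nat j ^ (?p - 1) = (if j = 0 then 0 else (1 :: 'a))"
    proof (cases "j = 0")
      case True
      then show ?thesis using assms(1) prime_gt_1_nat[of ?p] by (simp add: power_0_left)
    next
      case False
      then have "of_nat j \<noteq> (0 :: 'a)"
        using j of_nat_eq_iff_below_CHAR[of j 0, where ?'a = 'a] p by simp
      moreover have "of_nat j * of_nat j ^ (?p - 1) = (of_nat j :: 'a)"
        using of_nat_power_CHAR[OF assms(1), of j] p by (cases ?p) auto
      ultimately show ?thesis using False by simp
    qed
  qed simp
  also have "\<dots> = of_nat (?p - 1)"
  proof -
    have "{..<?p} \<inter> - {0} = {..<?p} - {0}" by auto
    then show ?thesis using p by (simp add: sum.If_cases flip: Compl_eq)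
  qed
  also have "\<dots> = (-1 :: 'a)"
    using p by (simp add: of_nat_diff)
  finally show ?thesis by (simp add: R)
qed

text \<open>The \<open>m\<close> distinct powers of \<open>\<zeta>\<close> are already all the roots of \<open>X^m - 1\<close>.\<close>

lemma root_of_unity_power:
  fixes \<zeta> z :: "'a::field"
  assumes "primitive_root_of_unity m \<zeta>" "0 < m" "z ^ m = 1"
  shows "\<exists>b. z = \<zeta> ^ b"
proof -
  have \<zeta>: "\<zeta> ^ m = 1" "\<And>j. 0 < j \<Longrightarrow> j < m \<Longrightarrow> \<zeta> ^ j \<noteq> 1"
    using assms(1) by (auto simp: primitive_root_of_unity_def)
  have "\<zeta> \<noteq> 0" using \<zeta>(1) assms(2) by (auto simp: power_0_left)
  have *: "i = j" if "\<zeta> ^ i = \<zeta> ^ j" "i \<le> j" "j < m" for i j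
  proof -
    have "\<zeta> ^ i * \<zeta> ^ (j - i) = \<zeta> ^ i * 1"
      unfolding power_add[symmetric] using that by simp
    then have "\<zeta> ^ (j - i) = 1" using \<open>\<zeta> \<noteq> 0\<close> by simp
    then show "i = j" using \<zeta>(2)[of "j - i"] that by linarith
  qed
  have inj: "inj_on (\<lambda>b. \<zeta> ^ b) {..<m}"
  proof (rule inj_onI)
    fix i j assume "i \<in> {..<m}" "j \<in> {..<m}" "\<zeta> ^ i = \<zeta> ^ j"
    then show "i = j" using *[of i j] *[of j i] by (cases "i \<le> j") auto
  qed
  have deg: "degree (monom (1 :: 'a) m - 1) = m"
    using assms(2) unfolding diff_conv_add_uminus
    by (subst degree_add_eq_left) (auto simp: degree_monom_eq)
  have "z \<in> (\<lambda>b. \<zeta> ^ b) ` {..<m}"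
  proof (rule root_mem_if_enough_roots[where P = "monom 1 m - 1"])
    show "monom 1 m - (1 :: 'a poly) \<noteq> 0" using deg assms(2) by auto
    show "poly (monom 1 m - 1) x = 0" if x: "x \<in> (\<lambda>b. \<zeta> ^ b) ` {..<m}" for x
    proof -
      obtain b where "x = \<zeta> ^ b" using x by blast
      then have "x ^ m = (\<zeta> ^ m) ^ b" by (simp add: mult.commute flip: power_mult)
      then show ?thesis using \<zeta>(1) by (simp add: poly_monom)
    qed
    show "poly (monom 1 m - 1) z = 0" using assms(3) by (simp add: poly_monom)
    show "degree (monom (1 :: 'a) m - 1) \<le> card ((\<lambda>b. \<zeta> ^ b) ` {..<m})"
      using inj by (simp add: deg card_image)
  qed simp
  then show ?thesis by blast
qed

section \<open>Evaluation of polynomials in several variables\<close>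

definition coeff_hom :: "('a::comm_ring_1 \<Rightarrow> 'b::comm_ring_1) \<Rightarrow> bool" where
  "coeff_hom h \<longleftrightarrow> h 0 = 0 \<and> h 1 = 1 \<and> (\<forall>a b. h (a + b) = h a + h b) \<and> (\<forall>a b. h (a * b) = h a * h b)"

lemma coeff_hom_id: "coeff_hom (\<lambda>c. c)"
  by (simp add: coeff_hom_def)

lemma coeff_hom_const: "coeff_hom const"
  by (simp add: coeff_hom_def const_def single_add mult_single)

definition monom_val :: "(nat \<Rightarrow> 'b::comm_ring_1) \<Rightarrow> (nat \<Rightarrow>\<^sub>0 nat) \<Rightarrow> 'b" where
  "monom_val y t = (\<Prod>i \<in> Poly_Mapping.keys t. y i ^ Poly_Mapping.lookup t i)"

lemma monom_val_superset:
  assumes "finite I" "Poly_Mapping.keys t \<subseteq> I"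
  shows "monom_val y t = (\<Prod>i\<in>I. y i ^ Poly_Mapping.lookup t i)"
  unfolding monom_val_def using assms
  by (intro prod.mono_neutral_left) (auto simp: in_keys_iff)

lemma monom_val_add: "monom_val y (s + t) = monom_val y s * monom_val y t"
proof -
  let ?I = "Poly_Mapping.keys s \<union> Poly_Mapping.keys t"
  have "monom_val y (s + t) = (\<Prod>i\<in>?I. y i ^ Poly_Mapping.lookup (s + t) i)"
    by (intro monom_val_superset keys_add) auto
  also have "\<dots> = (\<Prod>i\<in>?I. y i ^ Poly_Mapping.lookup s i) * (\<Prod>i\<in>?I. y i ^ Poly_Mapping.lookup t i)"
    by (simp add: lookup_add power_add prod.distrib)
  also have "\<dots> = monom_val y s * monom_val y t"
    by (simp add: monom_val_superset[of ?I])
  finally show ?thesis .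
qed

lemma insertion_superset:
  assumes "coeff_hom h" "finite K" "Poly_Mapping.keys f \<subseteq> K"
  shows "insertion h y f = (\<Sum>t\<in>K. h (Poly_Mapping.lookup f t) * monom_val y t)"
  unfolding insertion_def monom_val_def[symmetric] using assms
  by (intro sum.mono_neutral_left) (auto simp: coeff_hom_def in_keys_iff)

lemma insertion_add:
  assumes "coeff_hom h"
  shows "insertion h y (f + g) = insertion h y f + insertion h y g"
proof -
  let ?K = "Poly_Mapping.keys f \<union> Poly_Mapping.keys g"
  have "insertion h y (f + g) = (\<Sum>t\<in>?K. h (Poly_Mapping.lookup (f + g) t) * monom_val y t)"
    by (intro insertion_superset assms keys_add) auto
  also have "\<dots> = (\<Sum>t\<in>?K. h (Poly_Mapping.lookup f t) * monom_val y t)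
      + (\<Sum>t\<in>?K. h (Poly_Mapping.lookup g t) * monom_val y t)"
    using assms by (simp add: coeff_hom_def lookup_add algebra_simps sum.distrib)
  also have "\<dots> = insertion h y f + insertion h y g"
    by (simp add: insertion_superset[OF assms, of ?K])
  finally show ?thesis .
qed

lemma insertion_0 [simp]: "insertion h y 0 = 0"
  by (simp add: insertion_def)

lemma insertion_single:
  assumes "coeff_hom h"
  shows "insertion h y (Poly_Mapping.single t c) = h c * monom_val y t"
  using insertion_superset[OF assms, of "{t}" "Poly_Mapping.single t c" y] by simp

lemma mpoly_induct [case_names zero single add]:
  assumes "P 0" "\<And>t c. P (Poly_Mapping.single t c)" "\<And>f g. P f \<Longrightarrow> P g \<Longrightarrow> P (f + g)"
  shows "P (f :: 'a::comm_ring_1 mpoly)"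
proof (induction f rule: update_induct)
  case const
  then show ?case by (simp add: assms(1))
next
  case (update f t c)
  have "Poly_Mapping.update t c f = f + Poly_Mapping.single t c"
    using update.hyps(1)
    by (intro poly_mapping_eqI) (auto simp: lookup_update lookup_add lookup_single in_keys_iff when_def)
  then show ?case
    using assms(2,3) update.IH by simp
qed

lemma insertion_mult:
  assumes "coeff_hom h"
  shows "insertion h y (f * g) = insertion h y f * insertion h y g"
proof (induction f rule: mpoly_induct)
  case (single s a)
  show ?case
  proof (induction g rule: mpoly_induct)
    case (single t b)
    then show ?case
      using assms by (simp add: mult_single insertion_single monom_val_add coeff_hom_def)
  qed (simp_all add: insertion_add[OF assms] algebra_simps)
qed (simp_all add: insertion_add[OF assms] algebra_simps)

lemma insertion_1 [simp]: "coeff_hom h \<Longrightarrow> insertion h y 1 = 1"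
  using insertion_single[of h y 0 1] by (simp add: monom_val_def coeff_hom_def)

lemma insertion_const [simp]: "coeff_hom h \<Longrightarrow> insertion h y (const c) = h c"
  by (simp add: const_def insertion_single monom_val_def)

lemma insertion_var [simp]: "coeff_hom h \<Longrightarrow> insertion h y (var i) = y i"
  by (simp add: var_def insertion_single monom_val_def coeff_hom_def)

lemma insertion_power: "coeff_hom h \<Longrightarrow> insertion h y (f ^ k) = insertion h y f ^ k"
  by (induction k) (simp_all add: insertion_mult)

lemma insertion_sum: "coeff_hom h \<Longrightarrow> insertion h y (\<Sum>x\<in>A. f x) = (\<Sum>x\<in>A. insertion h y (f x))"
  by (induction A rule: infinite_finite_induct) (simp_all add: insertion_add)

lemma insertion_prod: "coeff_hom h \<Longrightarrow> insertion h y (\<Prod>x\<in>A. f x) = (\<Prod>x\<in>A. insertion h y (f x))"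
  by (induction A rule: infinite_finite_induct) (simp_all add: insertion_mult)

lemma monom_val_insertion:
  "monom_val (\<lambda>i. insertion (\<lambda>c. c) z (q i)) t = insertion (\<lambda>c. c) z (monom_val q t)"
  by (simp add: monom_val_def insertion_prod insertion_power coeff_hom_id)

text \<open>Substituting polynomials and then evaluating is the same as evaluating at the values of the
  substituted polynomials. This turns pullbacks into composition of functions.\<close>

lemma insertion_insertion:
  "insertion (\<lambda>c. c) z (insertion const q f) = insertion (\<lambda>c. c) (\<lambda>i. insertion (\<lambda>c. c) z (q i)) f"
proof (induction f rule: mpoly_induct)
  case (single t c)
  then show ?case
    by (simp add: insertion_single coeff_hom_id coeff_hom_const insertion_mult monom_val_insertion)
qed (simp_all add: insertion_add coeff_hom_id coeff_hom_const)

lemma poly_ring_0 [simp]: "0 \<in> poly_ring n"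
  and poly_ring_const [simp]: "const c \<in> poly_ring n"
  and poly_ring_1 [simp]: "1 \<in> poly_ring n"
  by (auto simp: poly_ring_def const_def)

lemma poly_ring_var: "i \<in> {1..n} \<Longrightarrow> var i \<in> poly_ring n"
  by (auto simp: poly_ring_def var_def)

lemma poly_ring_add: "f \<in> poly_ring n \<Longrightarrow> g \<in> poly_ring n \<Longrightarrow> f + g \<in> poly_ring n"
  unfolding poly_ring_def using keys_add[of f g] by blast

lemma poly_ring_mult:
  assumes "f \<in> poly_ring n" "g \<in> poly_ring n"
  shows "f * g \<in> poly_ring n"
  unfolding poly_ring_def
proof (intro CollectI ballI)
  fix t assume "t \<in> Poly_Mapping.keys (f * g)"
  then obtain a b where "t = a + b" "a \<in> Poly_Mapping.keys f" "b \<in> Poly_Mapping.keys g"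
    using keys_mult[of f g] by blast
  then show "Poly_Mapping.keys t \<subseteq> {1..n}"
    using assms keys_add[of a b] unfolding poly_ring_def by blast
qed

lemma poly_ring_power: "f \<in> poly_ring n \<Longrightarrow> f ^ k \<in> poly_ring n"
  by (induction k) (simp_all add: poly_ring_mult)

lemma poly_ring_sum: "(\<And>x. x \<in> A \<Longrightarrow> f x \<in> poly_ring n) \<Longrightarrow> (\<Sum>x\<in>A. f x) \<in> poly_ring n"
  by (induction A rule: infinite_finite_induct) (simp_all add: poly_ring_add)

lemma poly_ring_prod: "(\<And>x. x \<in> A \<Longrightarrow> f x \<in> poly_ring n) \<Longrightarrow> (\<Prod>x\<in>A. f x) \<in> poly_ring n"
  by (induction A rule: infinite_finite_induct) (simp_all add: poly_ring_mult)

lemma poly_ring_insertion: "(\<And>i. q i \<in> poly_ring n) \<Longrightarrow> insertion const q f \<in> poly_ring n"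
  unfolding insertion_def
  by (intro poly_ring_sum poly_ring_mult poly_ring_prod poly_ring_power) auto

text \<open>Substituting \<open>x_i = X^(q^i)\<close> for this \<open>q\<close> sends distinct monomials of \<open>T\<close> to distinct powers
  of \<open>X\<close> (Kronecker substitution). That \<open>q\<close> exists follows by applying the moment curve to the
  differences of exponent vectors, with the natural numbers as parameters.\<close>

lemma separating_weight:
  fixes T :: "(nat \<Rightarrow>\<^sub>0 nat) set"
  assumes "finite T" "\<And>t. t \<in> T \<Longrightarrow> Poly_Mapping.keys t \<subseteq> {1..n}"
  shows "\<exists>q. inj_on (\<lambda>t. \<Sum>i = 1..n. Poly_Mapping.lookup t i * q ^ i) T"
proof -
  define d :: "(nat \<Rightarrow>\<^sub>0 nat) \<times> (nat \<Rightarrow>\<^sub>0 nat) \<Rightarrow> nat \<Rightarrow> int"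
    where "d = (\<lambda>(s, t) i. int (Poly_Mapping.lookup s i) - int (Poly_Mapping.lookup t i))"
  define D where "D = d ` (T \<times> T - Id)"
  have "finite D"
    unfolding D_def using assms(1) by (intro finite_imageI finite_Diff finite_cartesian_product)
  moreover have "\<exists>i\<in>{1..n}. c i \<noteq> 0" if c: "c \<in> D" for c
  proof -
    obtain x where x: "x \<in> T \<times> T - Id" "c = d x"
      using c unfolding D_def by blast
    obtain s t where st: "x = (s, t)" by (cases x)
    then have st: "s \<in> T" "t \<in> T" "s \<noteq> t" "c = d (s, t)"
      using x by blast+
    then obtain i where i: "Poly_Mapping.lookup s i \<noteq> Poly_Mapping.lookup t i"
      using poly_mapping_eqI[of s t] by metis
    then have "i \<in> Poly_Mapping.keys s \<union> Poly_Mapping.keys t"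
      by (auto simp: in_keys_iff)
    then have "i \<in> {1..n}" using assms(2)[OF st(1)] assms(2)[OF st(2)] by blast
    with i st(4) show ?thesis by (auto simp: d_def)
  qed
  moreover have "infinite (range int)"
    by (simp add: range_inj_infinite)
  ultimately obtain q where q: "\<And>c. c \<in> D \<Longrightarrow> (\<Sum>i = 1..n. c i * int q ^ i) \<noteq> 0"
    using generic_point_on_moment_curve[of D n "range int"] by blast
  have "inj_on (\<lambda>t. \<Sum>i = 1..n. Poly_Mapping.lookup t i * q ^ i) T"
  proof (rule inj_onI, rule ccontr)
    fix s t assume st: "s \<in> T" "t \<in> T" "s \<noteq> t"
      and eq: "(\<Sum>i = 1..n. Poly_Mapping.lookup s i * q ^ i) = (\<Sum>i = 1..n. Poly_Mapping.lookup t i * q ^ i)"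
    have "(\<Sum>i = 1..n. d (s, t) i * int q ^ i)
        = int (\<Sum>i = 1..n. Poly_Mapping.lookup s i * q ^ i) - int (\<Sum>i = 1..n. Poly_Mapping.lookup t i * q ^ i)"
      by (simp add: d_def algebra_simps sum_subtractf)
    also have "\<dots> = 0" using eq by simp
    finally have "(\<Sum>i = 1..n. d (s, t) i * int q ^ i) = 0" .
    moreover have "d (s, t) \<in> D"
      unfolding D_def using st by blast
    ultimately show False using q by blast
  qed
  then show ?thesis by blast
qed

text \<open>Kronecker substitution reduces the claim to one variable: the substituted polynomial has the
  same coefficients and vanishes at infinitely many points.\<close>

lemma poly_ring_identity:
  fixes f :: "'a::idom mpoly"
  assumes "infinite (UNIV :: 'a set)" "f \<in> poly_ring n" "\<And>y. insertion (\<lambda>c. c) y f = 0"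
  shows "f = 0"
proof (rule ccontr)
  assume "f \<noteq> 0"
  then obtain s where s: "s \<in> Poly_Mapping.keys f"
    by (metis keys_eq_empty equals0I)
  have keys: "Poly_Mapping.keys t \<subseteq> {1..n}" if "t \<in> Poly_Mapping.keys f" for t
    using assms(2) that by (auto simp: poly_ring_def)
  obtain q where inj: "inj_on (\<lambda>t. \<Sum>i = 1..n. Poly_Mapping.lookup t i * q ^ i) (Poly_Mapping.keys f)"
    using separating_weight[OF finite_keys keys] by blast
  define e where "e = (\<lambda>t. \<Sum>i = 1..n. Poly_Mapping.lookup t i * q ^ i)"
  define P where "P = (\<Sum>t\<in>Poly_Mapping.keys f. monom (Poly_Mapping.lookup f t) (e t))"
  have "poly P x = 0" for x
  proof -
    have "monom_val (\<lambda>i. x ^ (q ^ i)) t = x ^ e t" if "t \<in> Poly_Mapping.keys f" for t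
      using keys[OF that]
      by (subst monom_val_superset[of "{1..n}"])
        (auto simp: e_def power_sum mult.commute simp flip: power_mult)
    then have "poly P x = insertion (\<lambda>c. c) (\<lambda>i. x ^ (q ^ i)) f"
      by (simp add: P_def poly_sum poly_monom insertion_def monom_val_def)
    then show ?thesis using assms(3) by simp
  qed
  then have "P = 0"
    using assms(1) poly_roots_finite[of P] by auto
  have "coeff P (e s) = (\<Sum>t\<in>Poly_Mapping.keys f. if t = s then Poly_Mapping.lookup f t else 0)"
    unfolding P_def coeff_sum coeff_monom
  proof (rule sum.cong)
    fix t assume "t \<in> Poly_Mapping.keys f"
    then have "e t = e s \<longleftrightarrow> t = s"
      using inj_on_eq_iff[OF inj] s unfolding e_def by simp
    then show "(if e t = e s then Poly_Mapping.lookup f t else 0) = (if t = s then Poly_Mapping.lookup f t else 0)"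
      by simp
  qed simp
  also have "\<dots> = Poly_Mapping.lookup f s"
    using s by simp
  finally show False
    using \<open>P = 0\<close> s by (simp add: in_keys_iff)
qed

lemma insertion_cong:
  assumes "f \<in> poly_ring n" "\<And>i. i \<in> {1..n} \<Longrightarrow> y i = z i"
  shows "insertion h y f = insertion h z f"
proof -
  have "monom_val y t = monom_val z t" if "t \<in> Poly_Mapping.keys f" for t
  proof -
    have "Poly_Mapping.keys t \<subseteq> {1..n}"
      using assms(1) that by (auto simp: poly_ring_def)
    then show ?thesis
      unfolding monom_val_def using assms(2) by (intro prod.cong) auto
  qed
  then show ?thesis
    by (simp add: insertion_def flip: monom_val_def)
qed

lemma insertion_diff:
  assumes "coeff_hom h"
  shows "insertion h y (f - g) = insertion h y f - insertion h y g"
  using insertion_add[OF assms, of y "f - g" g] by simp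

lemma poly_ring_diff: "f \<in> poly_ring n \<Longrightarrow> g \<in> poly_ring n \<Longrightarrow> f - g \<in> poly_ring n"
  unfolding poly_ring_def using keys_diff[of f g] by blast

section \<open>Polynomial functions on a based module\<close>

text \<open>Coordinates are indexed from 1. Rewriting this bound to \<open>Suc 0\<close> would keep facts about \<open>{1..n}\<close> from
  matching.\<close>

declare One_nat_def [simp del]

locale group_module = group G for G :: "('g, 'b) monoid_scheme" (structure) +
  fixes V :: "('g, 'f::field, 'v::ab_group_add) based_module"
  assumes based: "based_module G V"
begin

abbreviation "n \<equiv> mdim V"

sublocale vs: vector_space "smul V"
  using based by (simp add: based_module_def)

lemma basis:
  shows indep: "\<not> vs.dependent (bvec V ` {1..n})"
    and spanning: "v \<in> vs.span (bvec V ` {1..n})"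
    and inj_bvec: "inj_on (bvec V) {1..n}"
  using based by (auto simp: based_module_def)

lemma coord_add: "coord V i (u + v) = coord V i u + coord V i v"
  by (simp add: coord_def vs.representation_add[OF indep spanning spanning])

lemma coord_diff: "coord V i (u - v) = coord V i u - coord V i v"
  by (simp add: coord_def vs.representation_diff[OF indep spanning spanning])

lemma coord_smul: "coord V i (smul V c v) = c * coord V i v"
  by (simp add: coord_def vs.representation_scale[OF indep spanning])

lemma coord_0 [simp]: "coord V i 0 = 0"
  by (simp add: coord_def vs.representation_zero)

lemma coord_sum: "coord V i (\<Sum>x\<in>A. f x) = (\<Sum>x\<in>A. coord V i (f x))"
  by (induction A rule: infinite_finite_induct) (simp_all add: coord_add)

lemma coord_bvec:
  assumes "i \<in> {1..n}" "j \<in> {1..n}"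
  shows "coord V i (bvec V j) = (if i = j then 1 else 0)"
proof -
  have "coord V i (bvec V j) = (if bvec V i = bvec V j then 1 else 0)"
    unfolding coord_def using assms(2) by (subst vs.representation_basis[OF indep]) auto
  then show ?thesis
    using inj_on_eq_iff[OF inj_bvec assms] by simp
qed

lemma coord_expansion: "v = (\<Sum>j = 1..n. smul V (coord V j v) (bvec V j))"
proof -
  have "(\<Sum>b\<in>bvec V ` {1..n}. smul V (vs.representation (bvec V ` {1..n}) v b) b) = v"
    by (intro vs.sum_representation_eq indep spanning) auto
  then show ?thesis
    using inj_bvec by (simp add: sum.reindex coord_def)
qed

lemma coord_eqI:
  assumes "\<And>i. i \<in> {1..n} \<Longrightarrow> coord V i u = coord V i v"
  shows "u = v"
proof -
  have "(\<Sum>j = 1..n. smul V (coord V j u) (bvec V j)) = (\<Sum>j = 1..n. smul V (coord V j v) (bvec V j))"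
    using assms by (intro sum.cong) auto
  then show ?thesis
    using coord_expansion[of u] coord_expansion[of v] by metis
qed

lemma vector_with_coords:
  shows "\<exists>v. \<forall>i\<in>{1..n}. coord V i v = y i"
proof (intro exI ballI)
  fix i assume i: "i \<in> {1..n}"
  have "coord V i (\<Sum>j = 1..n. smul V (y j) (bvec V j)) = (\<Sum>j = 1..n. if i = j then y j else 0)"
    unfolding coord_sum coord_smul using i by (intro sum.cong) (auto simp: coord_bvec)
  then show "coord V i (\<Sum>j = 1..n. smul V (y j) (bvec V j)) = y i"
    using i by simp
qed

lemma eval_add: "eval V (f + g) v = eval V f v + eval V g v"
  and eval_mult: "eval V (f * g) v = eval V f v * eval V g v"
  and eval_power: "eval V (f ^ k) v = eval V f v ^ k"
  and eval_sum: "eval V (\<Sum>x\<in>A. F x) v = (\<Sum>x\<in>A. eval V (F x) v)"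
  and eval_prod: "eval V (\<Prod>x\<in>A. F x) v = (\<Prod>x\<in>A. eval V (F x) v)"
  and eval_const: "eval V (const c) v = c"
  and eval_var: "eval V (var i) v = coord V i v"
  by (simp_all add: eval_def insertion_add insertion_mult insertion_power insertion_sum
      insertion_prod coeff_hom_id)

text \<open>Every point of affine \<open>n\<close>-space is the coordinate vector of some \<open>v\<close>, so the identity theorem for polynomials applies.\<close>

lemma eval_eqI:
  assumes "infinite (UNIV :: 'f set)" "f \<in> poly_ring n" "g \<in> poly_ring n" "\<And>v. eval V f v = eval V g v"
  shows "f = g"
proof -
  have fg: "f - g \<in> poly_ring n"
    by (rule poly_ring_diff[OF assms(2,3)])
  have "insertion (\<lambda>c. c) y (f - g) = 0" for y
  proof -
    obtain v where v: "\<forall>i\<in>{1..n}. coord V i v = y i"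
      using vector_with_coords[of y] by (elim exE)
    have "insertion (\<lambda>c. c) y (f - g) = insertion (\<lambda>c. c) (\<lambda>i. coord V i v) (f - g)"
      using v by (intro insertion_cong[OF fg]) simp
    also have "\<dots> = eval V f v - eval V g v"
      unfolding eval_def by (rule insertion_diff[OF coeff_hom_id])
    also have "\<dots> = 0"
      using assms(4)[of v] by (rule right_minus_eq[THEN iffD2])
    finally show ?thesis .
  qed
  then have "f - g = 0"
    by (rule poly_ring_identity[OF assms(1) fg])
  then show ?thesis by (rule right_minus_eq[THEN iffD1])
qed

lemma rep_mult: "g \<in> carrier G \<Longrightarrow> h \<in> carrier G \<Longrightarrow> rep V (g \<otimes> h) v = rep V g (rep V h v)"
  using group_action.composition_rule[of G UNIV "rep V" v g h] based by (simp add: based_module_def)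

lemma rep_one: "rep V \<one> v = v"
  using group_action.id_eq_one[of G UNIV "rep V"] based
  by (metis UNIV_I based_module_def restrict_apply')

lemma rep_linear: "g \<in> carrier G \<Longrightarrow> Vector_Spaces.linear (smul V) (smul V) (rep V g)"
  using based by (simp add: based_module_def)

lemma coord_linear_image:
  assumes "group_module G W" "Vector_Spaces.linear (smul V) (smul W) L"
  shows "coord W i (L v) = (\<Sum>j = 1..n. coord V j v * coord W i (L (bvec V j)))"
proof -
  interpret W: group_module G W by fact
  interpret L: Vector_Spaces.linear "smul V" "smul W" L by fact
  show ?thesis
    by (subst coord_expansion[of v]) (simp add: L.sum L.scale W.coord_sum W.coord_smul)
qed

lemma eval_pullback:
  assumes "group_module G W" "Vector_Spaces.linear (smul V) (smul W) L"
  shows "eval V (pullback V W L f) v = eval W f (L v)"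
proof -
  have "eval V (pullback V W L f) v = insertion (\<lambda>c. c)
      (\<lambda>i. eval V (\<Sum>j = 1..n. const (coord W i (L (bvec V j))) * var j) v) f"
    unfolding eval_def pullback_def by (rule insertion_insertion)
  also have "\<dots> = eval W f (L v)"
    unfolding eval_def[of W]
    by (simp add: eval_sum eval_mult eval_const eval_var coord_linear_image[OF assms, of _ v] mult.commute)
  finally show ?thesis .
qed

lemma pullback_poly_ring: "pullback V W L f \<in> poly_ring n"
  unfolding pullback_def
  by (intro poly_ring_insertion poly_ring_sum poly_ring_mult poly_ring_var) auto

lemma eval_act: "g \<in> carrier G \<Longrightarrow> eval V (act G V g f) v = eval V f (rep V (inv g) v)"
  unfolding act_def by (intro eval_pullback rep_linear group_module_axioms inv_closed)

lemma act_poly_ring: "act G V g f \<in> poly_ring n"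
  unfolding act_def by (rule pullback_poly_ring)

text \<open>The action on polynomials uses the inverse of a group element. Over a subgroup the
  inverse disappears, since inversion permutes it.\<close>

lemma invariant_ring_iff:
  assumes "infinite (UNIV :: 'f set)" "subgroup K G"
  shows "f \<in> invariant_ring G V K \<longleftrightarrow>
    f \<in> poly_ring n \<and> (\<forall>g\<in>K. \<forall>v. eval V f (rep V g v) = eval V f v)"
proof -
  have K: "g \<in> carrier G" "inv g \<in> K" if "g \<in> K" for g
    using that assms(2) by (auto simp: subgroup.mem_carrier subgroup.m_inv_closed)
  have act: "act G V g f = f \<longleftrightarrow> (\<forall>v. eval V f (rep V (inv g) v) = eval V f v)"
    if "f \<in> poly_ring n" "g \<in> K" for g
    using that K(1) eval_act[of g f] eval_eqI[OF assms(1) act_poly_ring that(1), of g] by auto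
  have "(\<forall>g\<in>K. \<forall>v. eval V f (rep V (inv g) v) = eval V f v)
      \<longleftrightarrow> (\<forall>g\<in>K. \<forall>v. eval V f (rep V g v) = eval V f v)"
    using K by (metis inv_inv)
  then show ?thesis
    using act unfolding invariant_ring_def by blast
qed

lemma orbit_norm_poly_ring: "orbit_norm G V K f \<in> poly_ring n"
  unfolding orbit_norm_def by (intro poly_ring_prod act_poly_ring)

lemma rel_trace_poly_ring: "rel_trace G V K f \<in> poly_ring n"
  unfolding rel_trace_def by (intro poly_ring_sum act_poly_ring)

lemma eval_orbit_norm:
  assumes "subgroup K G"
  shows "eval V (orbit_norm G V K f) v = (\<Prod>g\<in>K. eval V f (rep V g v))"
proof -
  have K: "g \<in> carrier G" "inv g \<in> K" if "g \<in> K" for g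
    using that assms by (auto simp: subgroup.mem_carrier subgroup.m_inv_closed)
  have "eval V (orbit_norm G V K f) v = (\<Prod>g\<in>K. eval V f (rep V (inv g) v))"
    unfolding orbit_norm_def eval_prod using K by (intro prod.cong) (auto simp: eval_act)
  also have "\<dots> = (\<Prod>g\<in>K. eval V f (rep V g v))"
    by (rule prod.reindex_bij_witness[where i = "\<lambda>g. inv g" and j = "\<lambda>g. inv g"]) (use K in auto)
  finally show ?thesis .
qed

lemma translate_bij:
  assumes "subgroup K G" "h \<in> K"
  shows "bij_betw (\<lambda>g. g \<otimes> h) K K"
proof -
  interpret K: subgroup K G by fact
  show ?thesis
    by (rule bij_betw_byWitness[where f' = "\<lambda>g. g \<otimes> inv h"])
      (use assms(2) in \<open>auto simp: m_assoc\<close>)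
qed

lemma eval_orbit_norm_rep:
  assumes "subgroup K G" "h \<in> K"
  shows "eval V (orbit_norm G V K f) (rep V h v) = eval V (orbit_norm G V K f) v"
proof -
  interpret K: subgroup K G by fact
  have "(\<Prod>g\<in>K. eval V f (rep V g (rep V h v))) = (\<Prod>g\<in>K. eval V f (rep V (g \<otimes> h) v))"
    using assms(2) by (intro prod.cong) (auto simp: rep_mult)
  also have "\<dots> = (\<Prod>g\<in>K. eval V f (rep V g v))"
    using translate_bij[OF assms] by (rule prod.reindex_bij_betw)
  finally show ?thesis by (simp add: eval_orbit_norm[OF assms(1)])
qed

lemma orbit_norm_invariant:
  assumes "infinite (UNIV :: 'f set)" "subgroup K G"
  shows "orbit_norm G V K f \<in> invariant_ring G V K"
  using assms by (simp add: invariant_ring_iff orbit_norm_poly_ring eval_orbit_norm_rep)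

text \<open>An affine linear form that vanishes at \<open>u\<close> and at no point of the orbit of \<open>w\<close> has a norm over
  \<open>G\<close> that vanishes at \<open>u\<close> but not at \<open>w\<close>.\<close>

lemma invariants_separate_orbits:
  assumes "infinite (UNIV :: 'f set)" "finite (carrier G)"
    and inv: "\<And>f. f \<in> invariant_ring G V (carrier G) \<Longrightarrow> eval V f u = eval V f w"
  shows "\<exists>g\<in>carrier G. rep V g w = u"
proof (rule ccontr)
  assume orbit: "\<not> (\<exists>g\<in>carrier G. rep V g w = u)"
  define D where "D = (\<lambda>g i. coord V i (rep V g w) - coord V i u) ` carrier G"
  have "\<exists>i\<in>{1..n}. d i \<noteq> 0" if d: "d \<in> D" for d
  proof -
    obtain g where g: "g \<in> carrier G" "d = (\<lambda>i. coord V i (rep V g w) - coord V i u)"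
      using d by (auto simp: D_def)
    then have "rep V g w \<noteq> u" using orbit by blast
    then obtain i where "i \<in> {1..n}" "coord V i (rep V g w) \<noteq> coord V i u"
      using coord_eqI[of "rep V g w" u] by metis
    then show ?thesis using g(2) by auto
  qed
  then obtain t where t: "\<And>d. d \<in> D \<Longrightarrow> (\<Sum>i = 1..n. d i * t ^ i) \<noteq> 0"
    using generic_point_on_moment_curve[of D n UNIV] assms(1,2) by (auto simp: D_def)
  \<comment> \<open>By the choice of \<open>t\<close>, this form is nonzero at every point of the orbit of \<open>w\<close>.\<close>
  define f where "f = (\<Sum>i = 1..n. (var i + const (- coord V i u)) * const (t ^ i))"
  have f: "eval V f v = (\<Sum>i = 1..n. (coord V i v - coord V i u) * t ^ i)" for v
    by (simp add: f_def eval_sum eval_mult eval_add eval_var eval_const)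
  have "eval V f (rep V g w) \<noteq> 0" if "g \<in> carrier G" for g
    unfolding f using that by (intro t) (auto simp: D_def)
  then have "eval V (orbit_norm G V (carrier G) f) w \<noteq> 0"
    using assms(2) by (simp add: eval_orbit_norm[OF subgroup_self])
  moreover have "eval V f (rep V \<one> u) = 0"
    by (simp add: f rep_one)
  then have "eval V (orbit_norm G V (carrier G) f) u = 0"
    unfolding eval_orbit_norm[OF subgroup_self] using assms(2) by (intro prod_zero) auto
  moreover have "eval V (orbit_norm G V (carrier G) f) u = eval V (orbit_norm G V (carrier G) f) w"
    using assms(1) by (intro inv orbit_norm_invariant subgroup_self)
  ultimately show False by simp
qed

end

section \<open>The group of order \<open>pm\<close>\<close>

locale split_cyclic = group G for G :: "('g, 'b) monoid_scheme" (structure) +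
  fixes \<sigma> \<alpha> :: 'g and H M :: "'g set" and p m :: nat
  assumes prime_p: "prime p" and m_pos: "0 < m" and coprime: "coprime m p"
    and order_G: "Coset.order G = p * m"
    and subgroup_H: "subgroup H G" and card_H: "card H = p"
    and sigma_carrier: "\<sigma> \<in> carrier G" and generate_sigma: "generate G {\<sigma>} = H"
    and subgroup_M: "subgroup M G" and card_M: "card M = m"
    and alpha_carrier: "\<alpha> \<in> carrier G" and generate_alpha: "generate G {\<alpha>} = M"
begin

lemma p_pos: "0 < p"
  using prime_p by (rule prime_gt_0_nat)

lemma finite_carrier: "finite (carrier G)"
  using order_G p_pos m_pos by (simp add: Coset.order_def card_ge_0_finite)

text \<open>The Jordan block describes how \<open>\<sigma>\<inverse>\<close>, not \<open>\<sigma>\<close>, acts on vectors. Hence \<open>\<sigma>\<inverse>\<close> serves as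
  the generator of \<open>H\<close>.\<close>

abbreviation (input) s where "s \<equiv> inv \<sigma>"

lemma s_carrier: "s \<in> carrier G"
  using sigma_carrier by simp

lemma s_mem: "s \<in> H"
  using generate_sigma generate.inv[of \<sigma> "{\<sigma>}" G] by simp

lemma alpha_mem: "\<alpha> \<in> M"
  using generate_alpha generate.incl[of \<alpha> "{\<alpha>}" G] by simp

lemma H_carrier: "h \<in> H \<Longrightarrow> h \<in> carrier G" and M_carrier: "g \<in> M \<Longrightarrow> g \<in> carrier G"
  using subgroup_H subgroup_M by (simp_all add: subgroup.mem_carrier)

lemma M_powers: "g \<in> M \<Longrightarrow> \<exists>b :: nat. g = \<alpha> [^] b"
  using generate_pow_on_finite_carrier[OF finite_carrier alpha_carrier] generate_alpha by auto

lemma bij_betw_powers: "bij_betw (\<lambda>j :: nat. s [^] j) {..<p} H"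
proof -
  have ord: "ord \<sigma> = p"
    using generate_pow_card[OF sigma_carrier] generate_sigma card_H by simp
  have "{0..ord \<sigma> - 1} = {..<p}"
    using ord p_pos by auto
  moreover have "H = {\<sigma> [^] j |j. j \<in> {0..ord \<sigma> - 1}}"
    using generate_pow_on_finite_carrier[OF finite_carrier sigma_carrier] generate_sigma
      ord_elems[OF finite_carrier sigma_carrier] by simp
  ultimately have "bij_betw (\<lambda>j :: nat. \<sigma> [^] j) {..<p} H"
    using ord_inj[OF sigma_carrier] by (auto simp: bij_betw_def)
  moreover have "bij_betw (\<lambda>h. inv h) H H"
    by (rule bij_betw_byWitness[where f' = "\<lambda>h. inv h"])
      (use subgroup_H in \<open>auto simp: subgroup.m_inv_closed subgroup.mem_carrier\<close>)
  ultimately have "bij_betw ((\<lambda>h. inv h) \<circ> (\<lambda>j :: nat. \<sigma> [^] j)) {..<p} H"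
    by (rule bij_betw_trans)
  then show ?thesis
    using sigma_carrier by (simp add: comp_def nat_pow_inv)
qed

text \<open>The order of a common element divides \<open>p\<close> and \<open>m\<close>, which are coprime.\<close>

lemma H_int_M:
  assumes "x \<in> H" "x \<in> M"
  shows "x = \<one>"
proof -
  have x: "x \<in> carrier G" using assms(1) by (rule H_carrier)
  have exponent: "x [^] card K = \<one>" if K: "subgroup K G" "x \<in> K" for K
  proof -
    interpret K: subgroup K G by (rule K(1))
    interpret KG: group "G\<lparr>carrier := K\<rparr>"
      using K(1) by (rule subgroup_imp_group)
    have "x [^]\<^bsub>G\<lparr>carrier := K\<rparr>\<^esub> Coset.order (G\<lparr>carrier := K\<rparr>) = \<one>\<^bsub>G\<lparr>carrier := K\<rparr>\<^esub>"
      using K(2) by (intro KG.pow_order_eq_1) simp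
    then show ?thesis by (simp add: Coset.order_def nat_pow_def)
  qed
  have "ord x dvd p" "ord x dvd m"
    using exponent[OF subgroup_H assms(1)] exponent[OF subgroup_M assms(2)] x
    by (simp_all add: card_H card_M pow_eq_id)
  then have "ord x = 1"
    using coprime by (metis coprime_common_divisor_nat)
  then show ?thesis using x by (simp add: ord_eq_1)
qed

text \<open>Since \<open>H\<close> meets \<open>M\<close> trivially, its \<open>p\<close> elements lie in distinct cosets of \<open>M\<close>, and there are
  \<open>p\<close> cosets by Lagrange's theorem. So the relative trace is a sum over \<open>H\<close>.\<close>

lemma bij_betw_lcosets: "bij_betw (\<lambda>h. h <# M) H (lcosets M)"
proof -
  have inj: "inj_on (\<lambda>h. h <# M) H"
  proof (rule inj_onI)
    fix h h' assume h: "h \<in> H" "h' \<in> H" "h <# M = h' <# M"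
    have carr: "h \<in> carrier G" "h' \<in> carrier G" using h(1,2) H_carrier by auto
    have "h' \<in> h <# M"
      unfolding h(3) by (rule lcos_self[OF carr(2) subgroup_M])
    then have "inv h \<otimes> h' \<in> M"
      by (rule subgroup.lcos_module_imp[OF subgroup_M is_group carr(1)])
    moreover have "inv h \<otimes> h' \<in> H"
      using h(1,2) subgroup_H by (simp add: subgroup.m_closed subgroup.m_inv_closed)
    ultimately have "inv h \<otimes> h' = \<one>" by (intro H_int_M)
    then have "h \<otimes> (inv h \<otimes> h') = h \<otimes> \<one>" by simp
    then show "h = h'" using carr by (simp add: m_assoc[symmetric])
  qed
  have "card (lcosets M) * m = p * m"
    using l_lagrange[OF finite_carrier subgroup_M] by (simp add: card_M order_G)
  then have card: "card (lcosets M) = p" using m_pos by simp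
  then have "finite (lcosets M)" using p_pos by (simp add: card_ge_0_finite)
  moreover have "(\<lambda>h. h <# M) ` H \<subseteq> lcosets M"
    using H_carrier by (auto simp: LCOSETS_def)
  ultimately have "(\<lambda>h. h <# M) ` H = lcosets M"
    using inj by (intro card_seteq) (auto simp: card card_image card_H)
  with inj show ?thesis by (simp add: bij_betw_def)
qed

lemma factorization:
  assumes "g \<in> carrier G"
  shows "\<exists>(j :: nat) (b :: nat). g = s [^] j \<otimes> \<alpha> [^] b"
proof -
  have "g <# M \<in> lcosets M" using assms by (auto simp: LCOSETS_def)
  then obtain h where h: "h \<in> H" "g <# M = h <# M"
    using bij_betw_lcosets by (auto simp: bij_betw_def)
  then obtain a where "a \<in> M" "g = h \<otimes> a"
    using lcos_self[OF assms subgroup_M] by (auto simp: l_coset_def)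
  moreover obtain j :: nat where "h = s [^] j"
    using h(1) bij_betw_powers by (auto simp: bij_betw_def)
  ultimately show ?thesis using M_powers by blast
qed

lemma carrier_induct [consumes 1, case_names one alpha sigma]:
  assumes "g \<in> carrier G" "P \<one>"
    and alpha: "\<And>g. g \<in> carrier G \<Longrightarrow> P g \<Longrightarrow> P (\<alpha> \<otimes> g)"
    and sigma: "\<And>g. g \<in> carrier G \<Longrightarrow> P g \<Longrightarrow> P (s \<otimes> g)"
  shows "P g"
proof -
  obtain j b :: nat where g: "g = s [^] j \<otimes> \<alpha> [^] b"
    using factorization[OF assms(1)] by blast
  have a: "P (\<alpha> [^] b)" for b :: nat
  proof (induction b)
    case (Suc b)
    then show ?case using alpha[of "\<alpha> [^] b"] alpha_carrier by (metis nat_pow_Suc2 nat_pow_closed)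
  qed (simp add: assms(2))
  have "P (s [^] j \<otimes> \<alpha> [^] b)" for j :: nat
  proof (induction j)
    case (Suc j)
    have "s [^] Suc j \<otimes> \<alpha> [^] b = s \<otimes> (s [^] j \<otimes> \<alpha> [^] b)"
      using s_carrier alpha_carrier by (simp only: nat_pow_Suc2 m_assoc nat_pow_closed)
    then show ?case using sigma[OF _ Suc] s_carrier alpha_carrier by simp
  qed (use a alpha_carrier in simp)
  then show ?thesis using g by simp
qed

end

section \<open>The modules \<open>V_n\<close>\<close>

locale jordan = split_cyclic G \<sigma> \<alpha> H M p m + group_module G V
  for G :: "('g, 'b) monoid_scheme" (structure) and \<sigma> \<alpha> :: 'g and H M :: "'g set" and p m :: nat
    and V :: "('g, 'f::alg_closed_field, 'v::ab_group_add) based_module" +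
  fixes \<zeta> :: 'f
  assumes char_p: "CHAR('f) = p"
    and root: "primitive_root_of_unity m \<zeta>"
    and jordan: "jordan_module G \<sigma> \<alpha> \<zeta> n V"
begin

lemma prime_CHAR: "prime CHAR('f)"
  using prime_p char_p by simp

lemma infinite_field: "infinite (UNIV :: 'f set)"
  by (rule infinite_UNIV_alg_closed)

lemma zeta_power: "\<zeta> ^ m = 1" "\<zeta> \<noteq> 0"
proof -
  show *: "\<zeta> ^ m = 1" using root by (simp add: primitive_root_of_unity_def)
  show "\<zeta> \<noteq> 0" using * m_pos by (auto simp: power_0_left)
qed

lemma rep_alpha: "rep V \<alpha> v = smul V \<zeta> v"
proof (rule coord_eqI)
  fix i assume i: "i \<in> {1..n}"
  have "coord V i (rep V \<alpha> v) = (\<Sum>j = 1..n. coord V j v * coord V i (rep V \<alpha> (bvec V j)))"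
    by (rule coord_linear_image[OF group_module_axioms rep_linear[OF alpha_carrier]])
  also have "\<dots> = (\<Sum>j = 1..n. if i = j then \<zeta> * coord V j v else 0)"
    using i jordan
    by (intro sum.cong) (auto simp: jordan_module_def coord_smul coord_bvec)
  also have "\<dots> = coord V i (smul V \<zeta> v)" using i by (simp add: coord_smul)
  finally show "coord V i (rep V \<alpha> v) = coord V i (smul V \<zeta> v)" .
qed

text \<open>The matrix of \<open>\<sigma>\<inverse>\<close> adds the previous coordinate to each coordinate but the first.\<close>

lemma coord_rep_s:
  assumes "i \<in> {1..n}"
  shows "coord V i (rep V s v) = coord V i v + (if i = 1 then 0 else coord V (i - 1) v)"
proof -
  have bvec: "coord V i (rep V s (bvec V j)) = (if j = i then 1 else 0) + (if j = i - 1 then 1 else 0)"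
    if j: "j \<in> {1..n}" for j
  proof (cases "j = n")
    case True
    then show ?thesis
      using j assms jordan by (auto simp: jordan_module_def coord_bvec)
  next
    case False
    then have "rep V s (bvec V j) = bvec V j + bvec V (j + 1)"
      using j jordan by (simp add: jordan_module_def)
    then show ?thesis
      using j assms False by (auto simp: coord_add coord_bvec)
  qed
  have "coord V i (rep V s v) = (\<Sum>j = 1..n. coord V j v * coord V i (rep V s (bvec V j)))"
    by (rule coord_linear_image[OF group_module_axioms rep_linear[OF s_carrier]])
  also have "\<dots> = (\<Sum>j = 1..n. (if j = i then coord V j v else 0) + (if j = i - 1 then coord V j v else 0))"
    by (intro sum.cong) (auto simp: bvec)
  also have "\<dots> = coord V i v + (if i = 1 then 0 else coord V (i - 1) v)"
    using assms by (auto simp: sum.distrib)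
  finally show ?thesis .
qed

lemma rep_alpha_power: "rep V (\<alpha> [^] (b :: nat)) v = smul V (\<zeta> ^ b) v"
proof (induction b)
  case (Suc b)
  have "rep V (\<alpha> [^] Suc b) v = rep V \<alpha> (rep V (\<alpha> [^] b) v)"
    using alpha_carrier by (simp only: nat_pow_Suc2 rep_mult nat_pow_closed)
  then show ?case using Suc by (simp add: rep_alpha)
qed (simp add: rep_one)

lemma rep_s_Suc: "rep V (s [^] Suc j) v = rep V s (rep V (s [^] j) v)"
  using s_carrier by (simp only: nat_pow_Suc2 rep_mult nat_pow_closed)

text \<open>\<open>G\<close> is generated by \<open>\<sigma>\<inverse>\<close> and \<open>\<alpha>\<close>, and \<open>\<alpha>\<close> acts as the scalar \<open>\<zeta>\<close>.\<close>

lemma invariant_ringI: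
  assumes "f \<in> poly_ring n" "\<And>v. eval V f (rep V s v) = eval V f v"
    and "\<And>v. eval V f (smul V \<zeta> v) = eval V f v"
  shows "f \<in> invariant_ring G V (carrier G)"
proof -
  have "eval V f (rep V g v) = eval V f v" if "g \<in> carrier G" for g v
    using that
    by (induction rule: carrier_induct)
      (simp_all add: rep_one rep_mult alpha_carrier s_carrier rep_alpha assms(2,3))
  then show ?thesis
    using assms(1) by (simp add: invariant_ring_iff[OF infinite_field subgroup_self])
qed

lemma invariant_ring_M_iff:
  "f \<in> invariant_ring G V M \<longleftrightarrow> f \<in> poly_ring n \<and> (\<forall>v. eval V f (smul V \<zeta> v) = eval V f v)"
proof -
  have "eval V f (smul V (\<zeta> ^ b) v) = eval V f v"
    if "\<And>v. eval V f (smul V \<zeta> v) = eval V f v" for b v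
  proof (induction b)
    case (Suc b)
    have "smul V (\<zeta> ^ Suc b) v = smul V \<zeta> (smul V (\<zeta> ^ b) v)" by simp
    then show ?case using that Suc by metis
  qed simp
  then have "(\<forall>g\<in>M. \<forall>v. eval V f (rep V g v) = eval V f v) \<longleftrightarrow>
      (\<forall>v. eval V f (smul V \<zeta> v) = eval V f v)"
    using alpha_mem M_powers rep_alpha rep_alpha_power by metis
  then show ?thesis by (simp add: invariant_ring_iff[OF infinite_field subgroup_M])
qed

text \<open>By invariance under \<open>M\<close>, the representative chosen in each coset can be replaced by the
  one that lies in \<open>H\<close>.\<close>

lemma eval_rel_trace_H:
  assumes f: "f \<in> invariant_ring G V M"
  shows "eval V (rel_trace G V M f) v = (\<Sum>h\<in>H. eval V f (rep V h v))"
proof -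
  have "eval V (rel_trace G V M f) v = (\<Sum>h\<in>H. eval V (act G V (SOME g. g \<in> h <# M) f) v)"
    unfolding rel_trace_def eval_sum using bij_betw_lcosets by (rule sum.reindex_bij_betw[symmetric])
  also have "\<dots> = (\<Sum>h\<in>H. eval V f (rep V (inv h) v))"
  proof (rule sum.cong)
    fix h assume "h \<in> H"
    then have h: "h \<in> carrier G" by (rule H_carrier)
    have "(SOME g. g \<in> h <# M) \<in> h <# M"
      using lcos_self[OF h subgroup_M] by (rule someI)
    then obtain a where a: "a \<in> M" "(SOME g. g \<in> h <# M) = h \<otimes> a"
      by (auto simp: l_coset_def)
    have inv_a: "inv a \<in> M" "inv a \<in> carrier G" "a \<in> carrier G"
      using a(1) subgroup_M by (auto simp: subgroup.m_inv_closed M_carrier)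
    have "eval V (act G V (h \<otimes> a) f) v = eval V f (rep V (inv a) (rep V (inv h) v))"
      using h inv_a by (simp add: eval_act inv_mult_group rep_mult)
    also have "\<dots> = eval V f (rep V (inv h) v)"
      using f inv_a by (simp add: invariant_ring_iff[OF infinite_field subgroup_M])
    finally show "eval V (act G V (SOME g. g \<in> h <# M) f) v = eval V f (rep V (inv h) v)"
      unfolding a(2) .
  qed simp
  also have "\<dots> = (\<Sum>h\<in>H. eval V f (rep V h v))"
    by (rule sum.reindex_bij_witness[where i = "\<lambda>g. inv g" and j = "\<lambda>g. inv g"])
      (use subgroup_H H_carrier in \<open>auto simp: subgroup.m_inv_closed\<close>)
  finally show ?thesis .
qed

lemma eval_rel_trace:
  assumes "f \<in> invariant_ring G V M"
  shows "eval V (rel_trace G V M f) v = (\<Sum>j<p. eval V f (rep V (s [^] j) v))"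
  unfolding eval_rel_trace_H[OF assms]
  using bij_betw_powers by (rule sum.reindex_bij_betw[symmetric])

lemma eval_orbit_norm_H: "eval V (orbit_norm G V H f) v = (\<Prod>j<p. eval V f (rep V (s [^] j) v))"
  unfolding eval_orbit_norm[OF subgroup_H]
  using bij_betw_powers by (rule prod.reindex_bij_betw[symmetric])

lemma rep_smul: "g \<in> carrier G \<Longrightarrow> rep V g (smul V c v) = smul V c (rep V g v)"
  using rep_linear by (simp add: Vector_Spaces.linear_iff)

lemma rel_trace_invariant:
  assumes "f \<in> invariant_ring G V M"
  shows "rel_trace G V M f \<in> invariant_ring G V (carrier G)"
proof (rule invariant_ringI)
  fix v
  have "(\<Sum>h\<in>H. eval V f (rep V h (rep V s v))) = (\<Sum>h\<in>H. eval V f (rep V (h \<otimes> s) v))"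
    by (intro sum.cong) (simp_all add: rep_mult H_carrier s_carrier)
  also have "\<dots> = (\<Sum>h\<in>H. eval V f (rep V h v))"
    using translate_bij[OF subgroup_H s_mem] by (rule sum.reindex_bij_betw)
  finally show "eval V (rel_trace G V M f) (rep V s v) = eval V (rel_trace G V M f) v"
    by (simp add: eval_rel_trace_H[OF assms])
  have "eval V f (smul V \<zeta> v) = eval V f v" for v
    using assms by (simp add: invariant_ring_M_iff)
  then show "eval V (rel_trace G V M f) (smul V \<zeta> v) = eval V (rel_trace G V M f) v"
    by (simp add: eval_rel_trace_H[OF assms] rep_smul H_carrier)
qed (rule rel_trace_poly_ring)

text \<open>The first nonzero coordinate of a vector is fixed by the Jordan block, and therefore the next
  one grows in arithmetic progression.\<close>

lemma coord_power_s:
  assumes "i \<in> {1..n}" "\<And>r. r \<in> {1..<i} \<Longrightarrow> coord V r v = 0"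
  shows "r \<in> {1..<i} \<Longrightarrow> coord V r (rep V (s [^] (j :: nat)) v) = 0"
    and "coord V i (rep V (s [^] (j :: nat)) v) = coord V i v"
    and "i < n \<Longrightarrow> coord V (i + 1) (rep V (s [^] (j :: nat)) v) = coord V (i + 1) v + of_nat j * coord V i v"
proof -
  have 1: "\<forall>r\<in>{1..<i}. coord V r (rep V (s [^] j) v) = 0" for j :: nat
  proof (induction j)
    case 0
    then show ?case using assms by (simp add: rep_one)
  next
    case (Suc j)
    show ?case
    proof
      fix r assume "r \<in> {1..<i}"
      then have "r \<in> {1..n}" "r = 1 \<or> r - 1 \<in> {1..<i}"
        using assms(1) by auto
      then show "coord V r (rep V (s [^] Suc j) v) = 0"
        unfolding rep_s_Suc using Suc \<open>r \<in> {1..<i}\<close> by (auto simp: coord_rep_s)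
    qed
  qed
  then show "r \<in> {1..<i} \<Longrightarrow> coord V r (rep V (s [^] j) v) = 0" by blast
  have 2: "coord V i (rep V (s [^] j) v) = coord V i v" for j :: nat
  proof (induction j)
    case (Suc j)
    then show ?case
      unfolding rep_s_Suc using 1[of j] assms(1) by (auto simp: coord_rep_s)
  qed (simp add: rep_one)
  then show "coord V i (rep V (s [^] j) v) = coord V i v" .
  show "coord V (i + 1) (rep V (s [^] j) v) = coord V (i + 1) v + of_nat j * coord V i v" if "i < n"
  proof (induction j)
    case (Suc j)
    then show ?case
      unfolding rep_s_Suc using 2[of j] assms(1) that by (auto simp: coord_rep_s algebra_simps)
  qed (simp add: rep_one)
qed

text \<open>The difference \<open>u - w\<close> is a multiple of the last basis vector, which \<open>\<sigma>\<inverse>\<close> fixes.\<close>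

lemma coord_power_s_cong:
  assumes "\<And>r. r \<in> {1..<n} \<Longrightarrow> coord V r u = coord V r w" "0 < n"
  shows "r \<in> {1..<n} \<Longrightarrow> coord V r (rep V (s [^] (j :: nat)) u) = coord V r (rep V (s [^] j) w)"
    and "coord V n (rep V (s [^] (j :: nat)) u) - coord V n (rep V (s [^] j) w) = coord V n u - coord V n w"
proof -
  have rep_diff: "rep V g (u - w) = rep V g u - rep V g w" if "g \<in> carrier G" for g
  proof -
    interpret g: Vector_Spaces.linear "smul V" "smul V" "rep V g"
      using that by (rule rep_linear)
    show ?thesis by (rule g.diff)
  qed
  have zero: "coord V r (u - w) = 0" if "r \<in> {1..<n}" for r
    using that assms(1) by (simp add: coord_diff)
  show "coord V r (rep V (s [^] j) u) = coord V r (rep V (s [^] j) w)" if "r \<in> {1..<n}"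
    using coord_power_s(1)[of n "u - w" r j] that zero assms(2) s_carrier
    by (simp add: rep_diff coord_diff)
  show "coord V n (rep V (s [^] j) u) - coord V n (rep V (s [^] j) w) = coord V n u - coord V n w"
    using coord_power_s(2)[of n "u - w" j] zero assms(2) s_carrier
    by (simp add: rep_diff coord_diff)
qed

abbreviation "N_H f \<equiv> orbit_norm G V H f"

definition trace_poly :: "nat \<Rightarrow> nat \<Rightarrow> 'f mpoly" where
  "trace_poly j i = var n * var (i + 1) ^ (p - 1) * var i ^ j"

lemma eval_trace_poly:
  "eval V (trace_poly j i) v = coord V n v * coord V (i + 1) v ^ (p - 1) * coord V i v ^ j"
  by (simp add: trace_poly_def eval_mult eval_power eval_var)

lemma trace_poly_poly_ring: "i \<in> {1..n - 2} \<Longrightarrow> trace_poly j i \<in> poly_ring n"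
  unfolding trace_poly_def by (intro poly_ring_mult poly_ring_power poly_ring_var) auto

text \<open>The polynomial is homogeneous of degree \<open>p + j\<close>, so it is \<open>M\<close>-invariant as soon as \<open>m\<close> divides
  \<open>p + j\<close>, for example for \<open>j = p (m - 1)\<close>.\<close>

lemma exists_trace_poly_invariant: "\<exists>j. \<forall>i\<in>{1..n - 2}. trace_poly j i \<in> invariant_ring G V M"
proof (intro exI ballI)
  fix i assume i: "i \<in> {1..n - 2}"
  have exponent: "1 + (p - 1) + p * (m - 1) = m * p"
    using p_pos m_pos by (cases p; cases m) auto
  have "eval V (trace_poly (p * (m - 1)) i) (smul V \<zeta> v) = eval V (trace_poly (p * (m - 1)) i) v" for v
  proof -
    have "eval V (trace_poly (p * (m - 1)) i) (smul V \<zeta> v)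
        = \<zeta> ^ (1 + (p - 1) + p * (m - 1)) * eval V (trace_poly (p * (m - 1)) i) v"
      by (simp add: eval_trace_poly coord_smul power_mult_distrib power_add mult_ac)
    also have "\<zeta> ^ (1 + (p - 1) + p * (m - 1)) = 1"
      unfolding exponent power_mult by (simp add: zeta_power)
    finally show ?thesis by simp
  qed
  then show "trace_poly (p * (m - 1)) i \<in> invariant_ring G V M"
    using trace_poly_poly_ring[OF i] by (simp add: invariant_ring_M_iff)
qed

lemma eval_norm_var_smul: "eval V (N_H (var i)) (smul V c v) = c ^ p * eval V (N_H (var i)) v"
  by (simp add: eval_orbit_norm[OF subgroup_H] rep_smul H_carrier eval_var coord_smul
      prod.distrib card_H)

lemma norm_product_poly_ring: "N_H f * N_H g ^ j \<in> poly_ring n"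
  by (intro poly_ring_mult poly_ring_power orbit_norm_poly_ring)

text \<open>Each norm is \<open>H\<close>-invariant and homogeneous of degree \<open>p\<close>, so for \<open>j = m - 1\<close> the product has
  degree \<open>p m\<close> and is also fixed by the scalar \<open>\<zeta>\<close>.\<close>

lemma exists_norm_product_invariant:
  "\<exists>j. N_H (var i) * N_H (var i') ^ j \<in> invariant_ring G V (carrier G)"
proof (intro exI invariant_ringI norm_product_poly_ring)
  fix v
  let ?N = "N_H (var i) * N_H (var i') ^ (m - 1)"
  show "eval V ?N (rep V s v) = eval V ?N v"
    by (simp add: eval_mult eval_power eval_orbit_norm_rep[OF subgroup_H s_mem])
  have exponent: "p + p * (m - 1) = m * p"
    using m_pos by (cases m) auto
  have "eval V ?N (smul V \<zeta> v) = \<zeta> ^ (p + p * (m - 1)) * eval V ?N v"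
    by (simp add: eval_mult eval_power eval_norm_var_smul power_mult_distrib power_add mult_ac
        flip: power_mult)
  also have "\<zeta> ^ (p + p * (m - 1)) = 1"
    unfolding exponent power_mult by (simp add: zeta_power)
  finally show "eval V ?N (smul V \<zeta> v) = eval V ?N v" by simp
qed

text \<open>Summand by summand, only the factor \<open>x_n\<close> distinguishes \<open>u\<close> from \<open>w\<close>, and its difference does
  not depend on the summand. What remains is the sum of \<open>(p - 1)\<close>-st powers along the progression
  \<open>u_{i+1} + j u_i\<close>.\<close>

lemma eval_rel_trace_diff:
  assumes f: "trace_poly k i \<in> invariant_ring G V M" and i: "i \<in> {1..n - 2}"
    and eq: "\<And>r. r \<in> {1..<n} \<Longrightarrow> coord V r u = coord V r w"
    and zero: "\<And>r. r \<in> {1..<i} \<Longrightarrow> coord V r u = 0"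
    and nz: "coord V i u \<noteq> 0"
  shows "eval V (rel_trace G V M (trace_poly k i)) u - eval V (rel_trace G V M (trace_poly k i)) w
    = - (coord V n u - coord V n w) * coord V i u ^ (p - 1) * coord V i u ^ k"
proof -
  have n: "i \<in> {1..n}" "i < n" "i + 1 \<in> {1..<n}" "i \<in> {1..<n}" "0 < n"
    using i by auto
  have "eval V (trace_poly k i) (rep V (s [^] j) u) - eval V (trace_poly k i) (rep V (s [^] j) w)
      = (coord V n u - coord V n w) * coord V i u ^ k
        * (coord V (i + 1) u + of_nat j * coord V i u) ^ (p - 1)" for j :: nat
  proof -
    have u: "coord V i (rep V (s [^] j) u) = coord V i u"
      "coord V (i + 1) (rep V (s [^] j) u) = coord V (i + 1) u + of_nat j * coord V i u"
      by (rule coord_power_s(2)[OF n(1)] coord_power_s(3)[OF n(1) _ n(2)], erule zero)+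
    have w: "coord V r (rep V (s [^] j) w) = coord V r (rep V (s [^] j) u)" if "r \<in> {1..<n}" for r
      using eq n(5) that by (rule coord_power_s_cong(1)[symmetric])
    have "coord V n (rep V (s [^] j) u) - coord V n (rep V (s [^] j) w) = coord V n u - coord V n w"
      using eq n(5) by (rule coord_power_s_cong(2))
    then have "coord V n u - coord V n w
        = coord V n (rep V (s [^] j) u) - coord V n (rep V (s [^] j) w)" by (rule sym)
    then show ?thesis
      unfolding eval_trace_poly w[OF n(3)] w[OF n(4)] u by (simp only:) (simp add: algebra_simps)
  qed
  then have "eval V (rel_trace G V M (trace_poly k i)) u - eval V (rel_trace G V M (trace_poly k i)) w
      = (coord V n u - coord V n w) * coord V i u ^ k
        * (\<Sum>j<p. (coord V (i + 1) u + of_nat j * coord V i u) ^ (p - 1))"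
    unfolding eval_rel_trace[OF f] by (simp add: sum_distrib_left flip: sum_subtractf)
  then show ?thesis
    using sum_progression_power[OF prime_CHAR nz, of "coord V (i + 1) u"]
    by (simp add: char_p algebra_simps)
qed

lemma eval_norm_var_n:
  assumes "2 \<le> n" "\<And>r. r \<in> {1..<n - 1} \<Longrightarrow> coord V r v = 0"
  shows "eval V (N_H (var n)) v = (\<Prod>j<p. coord V n v + of_nat j * coord V (n - 1) v)"
    and "eval V (N_H (var (n - 1))) v = coord V (n - 1) v ^ p"
proof -
  have n: "n - 1 \<in> {1..n}" "n - 1 < n" "n - 1 + 1 = n" using assms(1) by auto
  show "eval V (N_H (var n)) v = (\<Prod>j<p. coord V n v + of_nat j * coord V (n - 1) v)"
    using coord_power_s(3)[OF n(1) assms(2) n(2)] by (simp add: n(3) eval_orbit_norm_H eval_var)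
  show "eval V (N_H (var (n - 1))) v = coord V (n - 1) v ^ p"
    using coord_power_s(2)[OF n(1) assms(2)] by (simp add: eval_orbit_norm_H eval_var)
qed

text \<open>A group element multiplies the last coordinate of a multiple of \<open>e_n\<close> by a power of \<open>\<zeta>\<close>, and the
  constant is the product of these powers.\<close>

lemma eval_full_norm_last:
  assumes "0 < n"
  shows "\<exists>c. c \<noteq> 0 \<and> (\<forall>v. (\<forall>r\<in>{1..<n}. coord V r v = 0) \<longrightarrow>
    eval V (orbit_norm G V (carrier G) (var n)) v = c * coord V n v ^ (p * m))"
proof -
  have "\<exists>c. c \<noteq> 0 \<and> (\<forall>v. (\<forall>r\<in>{1..<n}. coord V r v = 0) \<longrightarrow> coord V n (rep V g v) = c * coord V n v)"
    if g_carrier: "g \<in> carrier G" for g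
  proof -
    obtain j b :: nat where g: "g = s [^] j \<otimes> \<alpha> [^] b"
      using factorization[OF g_carrier] by blast
    have "coord V n (rep V g v) = \<zeta> ^ b * coord V n v" if "\<forall>r\<in>{1..<n}. coord V r v = 0" for v
      using coord_power_s(2)[of n "smul V (\<zeta> ^ b) v" j] that assms s_carrier alpha_carrier
      by (simp add: g rep_mult rep_alpha_power coord_smul)
    then show ?thesis using zeta_power(2) by (intro exI[of _ "\<zeta> ^ b"]) simp
  qed
  then obtain c where c: "\<And>g. g \<in> carrier G \<Longrightarrow> c g \<noteq> 0"
    "\<And>g v. g \<in> carrier G \<Longrightarrow> \<forall>r\<in>{1..<n}. coord V r v = 0 \<Longrightarrow> coord V n (rep V g v) = c g * coord V n v"
    by metis
  show ?thesis
  proof (intro exI conjI allI impI)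
    show "(\<Prod>g\<in>carrier G. c g) \<noteq> 0"
      using c(1) finite_carrier by simp
    fix v assume "\<forall>r\<in>{1..<n}. coord V r v = 0"
    then show "eval V (orbit_norm G V (carrier G) (var n)) v = (\<Prod>g\<in>carrier G. c g) * coord V n v ^ (p * m)"
      using order_G by (simp add: eval_orbit_norm[OF subgroup_self] eval_var c(2) prod.distrib Coset.order_def)
  qed
qed

lemma eq_if_coords:
  assumes "\<And>r. r \<in> {1..<n} \<Longrightarrow> coord V r u = coord V r w" "coord V n u = coord V n w"
  shows "u = w"
proof (rule coord_eqI)
  fix i assume "i \<in> {1..n}"
  then show "coord V i u = coord V i w"
    using assms by (cases "i = n") auto
qed

text \<open>The trace polynomials, the \<open>H\<close>-norms and the \<open>G\<close>-norm handle in turn the vectors whose first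
  nonzero coordinate comes before the position \<open>n - 1\<close>, at it, and after it.\<close>

lemma separation_in_fibre:
  assumes n: "2 \<le> n"
    and eq: "\<And>r. r \<in> {1..<n} \<Longrightarrow> coord V r u = coord V r w"
    and trace_inv: "\<And>i. i \<in> {1..n - 2} \<Longrightarrow> trace_poly k i \<in> invariant_ring G V M"
    and trace: "\<And>i. i \<in> {1..n - 2} \<Longrightarrow>
      eval V (rel_trace G V M (trace_poly k i)) u = eval V (rel_trace G V M (trace_poly k i)) w"
    and norm_H: "eval V (N_H (var n) * N_H (var (n - 1)) ^ l) u = eval V (N_H (var n) * N_H (var (n - 1)) ^ l) w"
    and norm_G: "eval V (orbit_norm G V (carrier G) (var n)) u = eval V (orbit_norm G V (carrier G) (var n)) w"
  shows "\<exists>g\<in>carrier G. rep V g w = u"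
proof (cases "\<exists>i. i \<in> {1..n - 2} \<and> coord V i u \<noteq> 0")
  case True
  define i where "i = (LEAST i. i \<in> {1..n - 2} \<and> coord V i u \<noteq> 0)"
  have i: "i \<in> {1..n - 2}" "coord V i u \<noteq> 0"
    using LeastI_ex[OF True] unfolding i_def by auto
  have "coord V r u = 0" if "r \<in> {1..<i}" for r
  proof -
    have "r \<in> {1..n - 2}" "r < i" using that i(1) by auto
    then show ?thesis
      unfolding i_def using not_less_Least[of r "\<lambda>i. i \<in> {1..n - 2} \<and> coord V i u \<noteq> 0"] by blast
  qed
  then have "- (coord V n u - coord V n w) * coord V i u ^ (p - 1) * coord V i u ^ k = 0"
    using eval_rel_trace_diff[OF trace_inv i(1) eq _ i(2)] i(1) trace[OF i(1)] by simp
  then have "coord V n u = coord V n w" using i(2) by simp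
  then have "u = w" using eq by (intro eq_if_coords)
  then show ?thesis using rep_one one_closed by blast
next
  case False
  then have zero_u: "coord V r u = 0" if "r \<in> {1..<n - 1}" for r
    using that by auto
  have zero_w: "coord V r w = 0" if "r \<in> {1..<n - 1}" for r
    using zero_u[OF that] eq[of r] that by auto
  have n1: "n - 1 \<in> {1..n}" "n - 1 < n" "n - 1 + 1 = n" "n - 1 \<in> {1..<n}" "0 < n" "n \<in> {1..n}"
    using n by auto
  have last_eq: "coord V (n - 1) u = coord V (n - 1) w" using eq n1(4) .
  show ?thesis
  proof (cases "coord V (n - 1) u = 0")
    case False
    have "eval V (N_H (var (n - 1))) u = eval V (N_H (var (n - 1))) w"
      "eval V (N_H (var (n - 1))) u \<noteq> 0"
      using eval_norm_var_n(2)[OF n zero_u] eval_norm_var_n(2)[OF n zero_w] False last_eq by simp_all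
    then have "eval V (N_H (var n)) u = eval V (N_H (var n)) w"
      using norm_H by (simp add: eval_mult eval_power)
    then have "(\<Prod>j<p. coord V n w + of_nat j * coord V (n - 1) u) = (\<Prod>j<p. coord V n u + of_nat j * coord V (n - 1) u)"
      using eval_norm_var_n(1)[OF n zero_u] eval_norm_var_n(1)[OF n zero_w] last_eq by simp
    then obtain r where r: "coord V n u = coord V n w + of_nat r * coord V (n - 1) u"
      using Artin_Schreier_fibre[of "coord V (n - 1) u" "coord V n w" "coord V n u"] False p_pos
      by (auto simp: char_p)
    have "rep V (s [^] r) w = u"
    proof (rule eq_if_coords)
      show "coord V n (rep V (s [^] r) w) = coord V n u"
        using coord_power_s(3)[OF n1(1) zero_w n1(2), of r] r last_eq by (simp add: n1(3))
      fix i assume i: "i \<in> {1..<n}"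
      show "coord V i (rep V (s [^] r) w) = coord V i u"
      proof (cases "i = n - 1")
        case True
        then show ?thesis using coord_power_s(2)[OF n1(1) zero_w, of r] last_eq by simp
      next
        case False
        then have "i \<in> {1..<n - 1}" using i by auto
        then show ?thesis
          using coord_power_s(1)[OF n1(1) zero_w, of i r] zero_u by simp
      qed
    qed
    then show ?thesis using s_carrier nat_pow_closed by blast
  next
    case True
    have zero: "\<forall>r\<in>{1..<n}. coord V r u = 0" "\<forall>r\<in>{1..<n}. coord V r w = 0"
    proof -
      show "\<forall>r\<in>{1..<n}. coord V r u = 0"
      proof
        fix r assume "r \<in> {1..<n}"
        then have "r = n - 1 \<or> r \<in> {1..<n - 1}" by auto
        then show "coord V r u = 0" using True zero_u by blast
      qed
      then show "\<forall>r\<in>{1..<n}. coord V r w = 0" using eq by simp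
    qed
    obtain c where c: "c \<noteq> 0" "\<And>v. \<forall>r\<in>{1..<n}. coord V r v = 0 \<Longrightarrow>
        eval V (orbit_norm G V (carrier G) (var n)) v = c * coord V n v ^ (p * m)"
      using eval_full_norm_last[OF n1(5)] by blast
    have "coord V n u ^ (p * m) = coord V n w ^ (p * m)"
      using norm_G c(1) by (simp add: c(2)[OF zero(1)] c(2)[OF zero(2)])
    then have "(coord V n u ^ m) ^ CHAR('f) = (coord V n w ^ m) ^ CHAR('f)"
      by (simp add: char_p mult.commute flip: power_mult)
    then have power: "coord V n u ^ m = coord V n w ^ m"
      by (rule CHAR_power_inj[OF prime_CHAR])
    \<comment> \<open>If \<open>w_n = 0\<close> then \<open>u_n = 0\<close> too, and every exponent works.\<close>
    have "\<exists>b. coord V n u = \<zeta> ^ b * coord V n w"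
    proof (cases "coord V n w = 0")
      case True
      then show ?thesis using power m_pos by (simp add: power_0_left)
    next
      case False
      then have "(coord V n u / coord V n w) ^ m = 1"
        using power by (simp add: power_divide)
      then obtain b where "coord V n u / coord V n w = \<zeta> ^ b"
        using root_of_unity_power[OF root m_pos] by blast
      then show ?thesis using False by (auto simp: field_simps)
    qed
    then obtain b where b: "coord V n u = \<zeta> ^ b * coord V n w" by blast
    have "rep V (\<alpha> [^] b) w = u"
      using zero b by (intro eq_if_coords) (simp_all add: rep_alpha_power coord_smul)
    then show ?thesis using alpha_carrier nat_pow_closed by blast
  qed
qed

end

section \<open>The separating set\<close>

theorem proposition13:
  fixes G :: "('g, 'b) monoid_scheme"
    and H M :: "'g set" and \<sigma> \<alpha> :: 'g
    and p m n k l :: nat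
    and \<zeta> :: "'a::alg_closed_field"
    and V :: "('g, 'a, 'v::ab_group_add) based_module"
    and W :: "('g, 'a, 'w::ab_group_add) based_module"
    and \<phi> :: "'v \<Rightarrow> 'w"
    and f :: "nat \<Rightarrow> nat \<Rightarrow> 'a mpoly"
    and S T :: "'a mpoly set"
  assumes "prime p" and "CHAR('a) = p"
    and "0 < m" and "coprime m p"
    and "group G" and "cyclic_group G" and "Coset.order G = p * m"
    and "subgroup H G" and "card H = p" and "\<sigma> \<in> carrier G" and "generate G {\<sigma>} = H"
    and "subgroup M G" and "card M = m" and "\<alpha> \<in> carrier G" and "generate G {\<alpha>} = M"
    and "primitive_root_of_unity m \<zeta>"
    and "2 \<le> n" and "n \<le> p"
    and "jordan_module G \<sigma> \<alpha> \<zeta> n V"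
    and "jordan_module G \<sigma> \<alpha> \<zeta> (n - 1) W"
    and "Vector_Spaces.linear (smul V) (smul W) \<phi>"
    and "\<And>i. 1 \<le> i \<Longrightarrow> i \<le> n - 1 \<Longrightarrow> \<phi> (bvec V i) = bvec W i"
    and "\<phi> (bvec V n) = 0"
    and l: "l = (LEAST j. orbit_norm G V H (var n) * orbit_norm G V H (var (n - 1)) ^ j
                   \<in> invariant_ring G V (carrier G))"
    and f: "\<And>j i. f j i = var n * var (i + 1) ^ (p - 1) * var i ^ j"
    and k: "k = (LEAST j. \<forall>i \<in> {1..n - 2}. f j i \<in> invariant_ring G V M)"
    and T: "T = {orbit_norm G V H (var n) * orbit_norm G V H (var (n - 1)) ^ l,
                 orbit_norm G V (carrier G) (var n)}
               \<union> {rel_trace G V M (f k i) | i. i \<in> {1..n - 2}}"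
    and "separating_set G W S"
  shows "separating_set G V (pullback V W \<phi> ` S \<union> T)"
proof -
  have dims: "mdim V = n" "mdim W = n - 1"
    using assms(19,20) by (simp_all add: jordan_module_def)
  interpret G: group G by fact
  interpret C: split_cyclic G \<sigma> \<alpha> H M p m
    by (intro split_cyclic.intro split_cyclic_axioms.intro; fact assms)
  interpret V: jordan G \<sigma> \<alpha> H M p m V \<zeta>
    by unfold_locales (use assms(2,16,19) in \<open>simp_all add: jordan_module_def\<close>)
  interpret W: jordan G \<sigma> \<alpha> H M p m W \<zeta>
    by unfold_locales (use assms(2,16,20) in \<open>simp_all add: jordan_module_def\<close>)
  have f_eq: "f j i = V.trace_poly j i" for j i
    by (simp add: f V.trace_poly_def dims)
  have k_inv: "V.trace_poly k i \<in> invariant_ring G V M" if "i \<in> {1..n - 2}" for i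
    using LeastI_ex[OF V.exists_trace_poly_invariant] that unfolding k f_eq dims by blast
  have l_inv: "orbit_norm G V H (var n) * orbit_norm G V H (var (n - 1)) ^ l \<in> invariant_ring G V (carrier G)"
    using LeastI_ex[OF V.exists_norm_product_invariant[of n "n - 1"]] unfolding l .
  have T_inv: "T \<subseteq> invariant_ring G V (carrier G)"
    using l_inv V.orbit_norm_invariant[OF V.infinite_field G.subgroup_self]
    by (auto simp: T f_eq k_inv intro!: V.rel_trace_invariant)
  have \<phi>_coord: "coord W i (\<phi> v) = coord V i v" if i: "i \<in> {1..<n}" for i v
  proof -
    have "coord W i (\<phi> v) = (\<Sum>j = 1..n. coord V j v * coord W i (\<phi> (bvec V j)))"
      using V.coord_linear_image[OF W.group_module_axioms assms(21), of i v] unfolding dims .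
    also have "\<dots> = (\<Sum>j = 1..n. if i = j then coord V j v else 0)"
    proof (rule sum.cong)
      fix j assume j: "j \<in> {1..n}"
      show "coord V j v * coord W i (\<phi> (bvec V j)) = (if i = j then coord V j v else 0)"
      proof (cases "j = n")
        case True
        then show ?thesis using i assms(23) by simp
      next
        case False
        then have "j \<in> {1..n - 1}" "i \<in> {1..n - 1}" using i j by auto
        then show ?thesis using assms(22)[of j] W.coord_bvec[of i j] by (simp add: dims)
      qed
    qed simp
    also have "\<dots> = coord V i v" using i by simp
    finally show ?thesis .
  qed
  have \<phi>_equivariant: "\<phi> (rep V g v) = rep W g (\<phi> v)" if "g \<in> carrier G" for g v
    using that
  proof (induction rule: C.carrier_induct)
    case one
    show ?case by (simp add: V.rep_one W.rep_one)
  next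
    case (alpha g)
    have "\<phi> (smul V \<zeta> (rep V g v)) = smul W \<zeta> (\<phi> (rep V g v))"
      using assms(21) by (simp add: Vector_Spaces.linear_iff)
    then show ?case
      using alpha C.alpha_carrier by (simp add: V.rep_mult W.rep_mult V.rep_alpha W.rep_alpha)
  next
    case (sigma g)
    have "\<phi> (rep V (inv\<^bsub>G\<^esub> \<sigma>) x) = rep W (inv\<^bsub>G\<^esub> \<sigma>) (\<phi> x)" for x
    proof (rule W.coord_eqI)
      fix i assume "i \<in> {1..mdim W}"
      then have i: "i \<in> {1..<n}" "i \<in> {1..mdim V}" "i \<in> {1..mdim W}" "i = 1 \<or> i - 1 \<in> {1..<n}"
        using dims by auto
      show "coord W i (\<phi> (rep V (inv\<^bsub>G\<^esub> \<sigma>) x)) = coord W i (rep W (inv\<^bsub>G\<^esub> \<sigma>) (\<phi> x))"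
        using i(4) by (auto simp: \<phi>_coord[OF i(1)] V.coord_rep_s[OF i(2)] W.coord_rep_s[OF i(3)] \<phi>_coord)
    qed
    then show ?case
      using sigma C.s_carrier by (simp add: V.rep_mult W.rep_mult)
  qed
  have eval_\<phi>: "eval V (pullback V W \<phi> h) v = eval W h (\<phi> v)" for h v
    by (rule V.eval_pullback[OF W.group_module_axioms assms(21)])
  have S: "S \<subseteq> invariant_ring G W (carrier G)"
    and S_sep: "\<And>u w h. \<forall>h\<in>S. eval W h u = eval W h w \<Longrightarrow> h \<in> invariant_ring G W (carrier G) \<Longrightarrow>
      eval W h u = eval W h w"
    using assms(28) unfolding separating_set_def by blast+
  have inv_iff: "h \<in> invariant_ring G V (carrier G) \<longleftrightarrow>
      h \<in> poly_ring (mdim V) \<and> (\<forall>g\<in>carrier G. \<forall>v. eval V h (rep V g v) = eval V h v)" for h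
    by (rule V.invariant_ring_iff[OF V.infinite_field G.subgroup_self])
  have "pullback V W \<phi> h \<in> invariant_ring G V (carrier G)" if "h \<in> S" for h
    using S that W.invariant_ring_iff[OF W.infinite_field G.subgroup_self, of h]
    by (auto simp: inv_iff V.pullback_poly_ring eval_\<phi> \<phi>_equivariant)
  then have subset: "pullback V W \<phi> ` S \<union> T \<subseteq> invariant_ring G V (carrier G)"
    using T_inv by blast
  \<comment> \<open>First move \<open>w\<close> into the fibre of \<open>\<phi>\<close> through \<open>u\<close>, then move it inside the fibre.\<close>
  have "\<exists>g\<in>carrier G. rep V g w = u"
    if agree: "\<forall>h\<in>pullback V W \<phi> ` S \<union> T. eval V h u = eval V h w" for u w
  proof -
    have "\<forall>h\<in>S. eval W h (\<phi> u) = eval W h (\<phi> w)"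
      using agree by (auto simp flip: eval_\<phi>)
    then obtain g where g: "g \<in> carrier G" "rep W g (\<phi> w) = \<phi> u"
      using W.invariants_separate_orbits[OF W.infinite_field C.finite_carrier] S_sep by blast
    have T_agree: "eval V h u = eval V h (rep V g w)" if "h \<in> T" for h
    proof -
      have "eval V h (rep V g w) = eval V h w"
        using T_inv that g(1) inv_iff by blast
      then show ?thesis using agree that by auto
    qed
    have "\<exists>g'\<in>carrier G. rep V g' (rep V g w) = u"
    proof (rule V.separation_in_fibre)
      show "coord V r u = coord V r (rep V g w)" if "r \<in> {1..<mdim V}" for r
        using that g by (simp add: dims \<phi>_equivariant flip: \<phi>_coord)
    qed (use assms(17) k_inv T_agree in \<open>auto simp: dims T f_eq\<close>)
    then show ?thesis using g(1) V.rep_mult G.m_closed by metis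
  qed
  then have "\<forall>u w. (\<forall>h\<in>pullback V W \<phi> ` S \<union> T. eval V h u = eval V h w) \<longrightarrow>
      (\<forall>h\<in>invariant_ring G V (carrier G). eval V h u = eval V h w)"
    using inv_iff by metis
  then show ?thesis
    using subset unfolding separating_set_def by blast
qed

end
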